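(* Let $A$ be a complex $n\times n$ matrix and let $F_A(x)=x+(A.x)^3:\mathbb{C}^n\to\mathbb{C}^n$. Then $F_A$ is an automorphism (a polynomial map with polynomial inverse) if and only if the only solutions $(y,z)\in\mathbb{C}^n\times\mathbb{C}^n$ of $$z+A.(z^3)+A.(z*(A.y)^2)=0$$ are those with $z=0$.
   Context: For $u,v\in\mathbb{C}^n$, $u*v=(u_1v_1,\ldots,u_nv_n)$ is the coordinatewise product, and $u^k=u*\cdots*u$ ($k$ factors) is the coordinatewise power. $A.x$ denotes the matrix-vector product. *)

theory Defs
  imports "HOL-Analysis.Analysis"
begin

(* Coordinatewise products and powers of vectors are the library's ring structure on
   complex ^ 'n: (u * v) $ i = u $ i * v $ i, and u ^ k is the k-fold such product. *)

(* m ranges over a finite set of exponent vectors; the summand is c m times the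
   monomial with exponents m. *)
definition polynomial_fun :: "(complex ^ 'n \<Rightarrow> complex) \<Rightarrow> bool" where
  "polynomial_fun f \<longleftrightarrow>
     (\<exists>(M :: ('n \<Rightarrow> nat) set) c. finite M \<and>
        (\<forall>x. f x = (\<Sum>m\<in>M. c m * (\<Prod>i\<in>UNIV. (x $ i) ^ m i))))"

definition polynomial_map :: "(complex ^ 'n \<Rightarrow> complex ^ 'm) \<Rightarrow> bool" where
  "polynomial_map F \<longleftrightarrow> (\<forall>j. polynomial_fun (\<lambda>x. F x $ j))"

definition polynomial_automorphism :: "(complex ^ 'n \<Rightarrow> complex ^ 'n) \<Rightarrow> bool" where
  "polynomial_automorphism F \<longleftrightarrow>
     polynomial_map F \<and> (\<exists>G. polynomial_map G \<and> G \<circ> F = id \<and> F \<circ> G = id)"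

definition cubic_map :: "complex ^ 'n ^ 'n \<Rightarrow> complex ^ 'n \<Rightarrow> complex ^ 'n" where
  "cubic_map A x = x + (A *v x) ^ 3"

end

theory Submission
  imports Defs "HOL-Complex_Analysis.Complex_Analysis" "HOL-Computational_Algebra.Field_as_Ring"
    "HOL-Computational_Algebra.Polynomial_Factorial"
begin

no_notation fps_nth (infixl \<open>$\<close> 75)

text \<open>
  Writing two points as $u + v$ and $u - v$, the map $F = F_A$ identifies them iff
  $v + (Av)^3 + 3 (Au)^2 (Av) = 0$; with $z = Av$ and $y = \sqrt 3 u$ this turns the condition of
  the theorem into injectivity of $F$. What remains is that an injective $F$ has a polynomial inverse.

  By invariance of domain the image $U$ of $F$ is open and $G = F^{-1}$ is continuous on $U$.
  Counting dimensions, every polynomial in $x$ is algebraic over the polynomials in $F(x)$. This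
  yields a polynomial $B \neq 0$ such that $B(F(x)) x$ is bounded by a power of $1 + |F(x)|$ and $F'(x)$
  is invertible where $B(F(x)) \neq 0$. Hence for generic $w$ the function $t \mapsto B(tw)^2 G(tw)$
  extends to an entire function of polynomial growth, so $G$ is rational on the ray
  $\mathbb{C} w$, and its Taylor coefficients at $0$ are polynomials in $w$ by the recursion
  that $F(G(tw)) = tw$ imposes.

  Poles are excluded as follows. Let $d$ be a reduced denominator of a coordinate of $G$ on a
  generic ray $\mathbb{C} w$, of maximal degree, and let $t_0 w = F(x_0)$. The rays through
  $w(s) = F(s x_0)/t_0$ give a bivariate reduced denominator $D(s,t)$, which has no zero with
  $t\,w(s) \in U$ by a Bezout relation and Hurwitz's theorem. So the polynomials $D(s,t_0)$,
  $D(s,0)$, $D(0,t)$ have no zeros and are constant, whence $D(1,t_0) = D(1,0)$. By maximality of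
  its degree, $d$ is a constant multiple of $D(1,t)$, so $d(t_0) = d(0)$ whenever
  $t_0 w \in U$, and $d$ is constant.
\<close>

subsection \<open>Polynomial functions\<close>

lemma polynomial_fun_monomial:
  "polynomial_fun (\<lambda>x. c * (\<Prod>i\<in>UNIV. (x $ i) ^ m i))"
  unfolding polynomial_fun_def by (rule exI[of _ "{m}"], rule exI[of _ "\<lambda>_. c"]) auto

lemma polynomial_fun_add:
  assumes "polynomial_fun f" "polynomial_fun g"
  shows "polynomial_fun (\<lambda>x. f x + g x)"
proof -
  from assms obtain M c N d where M: "finite M" "\<And>x. f x = (\<Sum>m\<in>M. c m * (\<Prod>i\<in>UNIV. (x $ i) ^ m i))"
    and N: "finite N" "\<And>x. g x = (\<Sum>m\<in>N. d m * (\<Prod>i\<in>UNIV. (x $ i) ^ m i))"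
    unfolding polynomial_fun_def by blast
  let ?c = "\<lambda>m. (if m \<in> M then c m else 0) + (if m \<in> N then d m else 0)"
  have "f x + g x = (\<Sum>m\<in>M \<union> N. ?c m * (\<Prod>i\<in>UNIV. (x $ i) ^ m i))" for x
  proof -
    have "f x = (\<Sum>m\<in>M \<union> N. (if m \<in> M then c m else 0) * (\<Prod>i\<in>UNIV. (x $ i) ^ m i))"
      unfolding M(2) by (rule sum.mono_neutral_cong_left) (use M N in auto)
    moreover have "g x = (\<Sum>m\<in>M \<union> N. (if m \<in> N then d m else 0) * (\<Prod>i\<in>UNIV. (x $ i) ^ m i))"
      unfolding N(2) by (rule sum.mono_neutral_cong_left) (use M N in auto)
    ultimately show ?thesis by (simp only: sum.distrib[symmetric] distrib_right)
  qed
  then show ?thesis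
    unfolding polynomial_fun_def using M(1) N(1)
    by (intro exI[of _ "M \<union> N"] exI[of _ ?c]) auto
qed

lemma polynomial_fun_const: "polynomial_fun (\<lambda>x. c)"
  using polynomial_fun_monomial[of c "\<lambda>_. 0"] by simp

lemma polynomial_fun_sum:
  assumes "\<And>a. a \<in> S \<Longrightarrow> polynomial_fun (f a)"
  shows "polynomial_fun (\<lambda>x. \<Sum>a\<in>S. f a x)"
  using assms
  by (induction S rule: infinite_finite_induct) (auto simp: polynomial_fun_const intro!: polynomial_fun_add)

lemma polynomial_fun_mult:
  assumes "polynomial_fun f" "polynomial_fun g"
  shows "polynomial_fun (\<lambda>x. f x * g x)"
proof -
  from assms obtain M c N d where M: "finite M" "\<And>x. f x = (\<Sum>m\<in>M. c m * (\<Prod>i\<in>UNIV. (x $ i) ^ m i))"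
    and N: "finite N" "\<And>x. g x = (\<Sum>m\<in>N. d m * (\<Prod>i\<in>UNIV. (x $ i) ^ m i))"
    unfolding polynomial_fun_def by blast
  have "f x * g x = (\<Sum>m\<in>M. \<Sum>k\<in>N. (c m * d k) * (\<Prod>i\<in>UNIV. (x $ i) ^ (m i + k i)))" for x
    unfolding M N by (simp add: sum_product power_add prod.distrib mult_ac)
  then have "(\<lambda>x. f x * g x) = (\<lambda>x. \<Sum>m\<in>M. \<Sum>k\<in>N. (c m * d k) * (\<Prod>i\<in>UNIV. (x $ i) ^ (m i + k i)))"
    by blast
  then show ?thesis
    by (simp only:) (intro polynomial_fun_sum polynomial_fun_monomial)
qed

lemma polynomial_fun_coord: "polynomial_fun (\<lambda>x :: complex ^ 'n. x $ i)"
proof -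
  have "(\<Prod>j\<in>UNIV. (x $ j) ^ (if j = i then 1 else 0)) = x $ i" for x :: "complex ^ 'n"
    by (subst prod.remove[of _ i]) auto
  then show ?thesis using polynomial_fun_monomial[of 1 "\<lambda>j. if j = i then 1 else 0"] by simp
qed

lemma polynomial_fun_prod:
  assumes "\<And>a. a \<in> S \<Longrightarrow> polynomial_fun (f a)"
  shows "polynomial_fun (\<lambda>x. \<Prod>a\<in>S. f a x)"
  using assms
  by (induction S rule: infinite_finite_induct) (auto simp: polynomial_fun_const intro!: polynomial_fun_mult)

lemma polynomial_fun_power:
  assumes "polynomial_fun f"
  shows "polynomial_fun (\<lambda>x. f x ^ k)"
  using assms by (induction k) (auto simp: polynomial_fun_const intro!: polynomial_fun_mult)

lemma polynomial_fun_diff: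
  assumes "polynomial_fun f" "polynomial_fun g"
  shows "polynomial_fun (\<lambda>x. f x - g x)"
  using polynomial_fun_add[OF assms(1) polynomial_fun_mult[OF polynomial_fun_const[of "-1"] assms(2)]]
  by simp

lemmas polynomial_fun_intros = polynomial_fun_const polynomial_fun_coord polynomial_fun_add
  polynomial_fun_diff polynomial_fun_mult polynomial_fun_power polynomial_fun_sum polynomial_fun_prod

text \<open>Polynomial functions are generated by constants and coordinates under sums and products;
  continuity, growth and restriction to curves are then proved case by case.\<close>

lemma polynomial_fun_induct [consumes 1, case_names const coord add mult]:
  fixes f :: "complex ^ 'n \<Rightarrow> complex"
  assumes f: "polynomial_fun f"
    and const: "\<And>c. P (\<lambda>x. c)"
    and coord: "\<And>i. P (\<lambda>x. x $ i)"
    and add: "\<And>f g. P f \<Longrightarrow> P g \<Longrightarrow> P (\<lambda>x. f x + g x)"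
    and mult: "\<And>f g. P f \<Longrightarrow> P g \<Longrightarrow> P (\<lambda>x. f x * g x)"
  shows "P f"
proof -
  from f obtain M c where M: "finite M" "\<And>x. f x = (\<Sum>m\<in>M. c m * (\<Prod>i\<in>UNIV. (x $ i) ^ m i))"
    unfolding polynomial_fun_def by blast
  have pow: "P (\<lambda>x. (x $ i) ^ k)" for i k
  proof (induction k)
    case 0
    show ?case using const[of 1] by simp
  next
    case (Suc k)
    show ?case using mult[OF coord[of i] Suc] by simp
  qed
  have pr: "P (\<lambda>x. \<Prod>i\<in>I. (x $ i) ^ m i)" if "finite I" for I m
    using that
  proof (induction I rule: finite_induct)
    case empty
    show ?case using const[of 1] by simp
  next
    case (insert i I)
    show ?case using mult[OF pow[of i "m i"] insert.IH] insert.hyps by simp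
  qed
  have "P (\<lambda>x. \<Sum>m\<in>M. c m * (\<Prod>i\<in>UNIV. (x $ i) ^ m i))"
    using M(1)
  proof (induction M rule: finite_induct)
    case empty
    show ?case using const[of 0] by simp
  next
    case (insert m M)
    show ?case
      using add[OF mult[OF const[of "c m"] pr[of UNIV m]] insert.IH] insert.hyps by simp
  qed
  moreover have "f = (\<lambda>x. \<Sum>m\<in>M. c m * (\<Prod>i\<in>UNIV. (x $ i) ^ m i))" using M(2) by blast
  ultimately show ?thesis by simp
qed

lemma polynomial_fun_compose:
  assumes "polynomial_fun f" "polynomial_map G"
  shows "polynomial_fun (\<lambda>x. f (G x))"
  using assms(1)
  by (induction rule: polynomial_fun_induct)
     (use assms(2) in \<open>auto simp: polynomial_map_def intro: polynomial_fun_intros\<close>)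

lemma continuous_on_polynomial_fun:
  assumes "polynomial_fun f"
  shows "continuous_on S f"
  using assms
  by (induction rule: polynomial_fun_induct) (auto intro!: continuous_intros)

lemma continuous_on_polynomial_map:
  assumes "polynomial_map G"
  shows "continuous_on S G"
proof -
  have "continuous_on S (\<lambda>x. \<chi> j. G x $ j)"
    using assms by (intro continuous_on_vec_lambda continuous_on_polynomial_fun)
      (auto simp: polynomial_map_def)
  then show ?thesis by simp
qed

section \<open>Growth and restriction to curves and rays\<close>

lemma polynomial_fun_growth:
  fixes f :: "complex ^ 'n \<Rightarrow> complex"
  assumes "polynomial_fun f"
  shows "\<exists>C N. C \<ge> 0 \<and> (\<forall>x. norm (f x) \<le> C * (1 + norm x) ^ N)"
  using assms
proof (induction rule: polynomial_fun_induct)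
  case (const c)
  show ?case by (rule exI[of _ "norm c"], rule exI[of _ 0]) auto
next
  case (coord i)
  have "norm (x $ i) \<le> 1 * (1 + norm x) ^ 1" for x :: "complex ^ 'n"
    using Finite_Cartesian_Product.norm_nth_le[of x i] by simp
  then show ?case by (intro exI[of _ 1]) auto
next
  case (add f g)
  then obtain C N D M where C: "C \<ge> 0" "\<And>x. norm (f x) \<le> C * (1 + norm x) ^ N"
    and D: "D \<ge> 0" "\<And>x. norm (g x) \<le> D * (1 + norm x) ^ M" by blast
  have "norm (f x + g x) \<le> (C + D) * (1 + norm x) ^ (max N M)" for x
  proof -
    have "C * (1 + norm x) ^ N \<le> C * (1 + norm x) ^ (max N M)"
      "D * (1 + norm x) ^ M \<le> D * (1 + norm x) ^ (max N M)"
      using C(1) D(1) by (auto intro!: mult_left_mono power_increasing)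
    then show ?thesis
      using C(2)[of x] D(2)[of x] norm_triangle_ineq[of "f x" "g x"] by (simp add: algebra_simps)
  qed
  then show ?case using C(1) D(1) by (intro exI[of _ "C + D"] exI[of _ "max N M"]) auto
next
  case (mult f g)
  then obtain C N D M where C: "C \<ge> 0" "\<And>x. norm (f x) \<le> C * (1 + norm x) ^ N"
    and D: "D \<ge> 0" "\<And>x. norm (g x) \<le> D * (1 + norm x) ^ M" by blast
  have "norm (f x * g x) \<le> (C * D) * (1 + norm x) ^ (N + M)" for x
  proof -
    have "norm (f x) * norm (g x) \<le> (C * (1 + norm x) ^ N) * (D * (1 + norm x) ^ M)"
      using C D by (intro mult_mono) auto
    then show ?thesis by (simp add: norm_mult power_add mult_ac)
  qed
  then show ?case using C(1) D(1) by (intro exI[of _ "C * D"] exI[of _ "N + M"]) auto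
qed

lemma polynomial_fun_curve:
  assumes "polynomial_fun f"
  shows "\<exists>q. \<forall>t. f (\<chi> i. poly (u i) t) = poly q t"
  using assms
proof (induction rule: polynomial_fun_induct)
  case (const c)
  show ?case by (rule exI[of _ "[:c:]"]) simp
next
  case (coord i)
  show ?case by (rule exI[of _ "u i"]) simp
next
  case (add f g)
  then obtain p q where "\<forall>t. f (\<chi> i. poly (u i) t) = poly p t" "\<forall>t. g (\<chi> i. poly (u i) t) = poly q t"
    by blast
  then show ?case by (intro exI[of _ "p + q"]) simp
next
  case (mult f g)
  then obtain p q where "\<forall>t. f (\<chi> i. poly (u i) t) = poly p t" "\<forall>t. g (\<chi> i. poly (u i) t) = poly q t"
    by blast
  then show ?case by (intro exI[of _ "p * q"]) simp
qed

text \<open>The degree bound, uniform in \<open>w\<close>, later makes a denominator of maximal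
  degree exist. The polynomial dependence of the coefficients on \<open>w\<close> turns data on
  single rays into polynomial functions of \<open>w\<close>.\<close>

lemma polynomial_fun_ray:
  assumes "polynomial_fun f"
  shows "\<exists>q N. (\<forall>k. polynomial_fun (\<lambda>w. coeff (q w) k)) \<and>
           (\<forall>w. degree (q w) \<le> N) \<and> (\<forall>w t. f (t *s w) = poly (q w) t)"
  using assms
proof (induction rule: polynomial_fun_induct)
  case (const c)
  show ?case by (rule exI[of _ "\<lambda>w. [:c:]"], rule exI[of _ 0])
      (auto intro: polynomial_fun_intros)
next
  case (coord i)
  have "polynomial_fun (\<lambda>w. coeff [:0, w $ i:] k)" for k
    by (cases k; cases "k - 1") (auto simp: coeff_pCons intro: polynomial_fun_intros)
  then show ?case
    by (intro exI[of _ "\<lambda>w. [:0, w $ i:]"] exI[of _ 1]) auto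
next
  case (add f g)
  from add(1) obtain p N where p:
    "\<And>k. polynomial_fun (\<lambda>w. coeff (p w) k)" "\<And>w. degree (p w) \<le> N" "\<And>w t. f (t *s w) = poly (p w) t"
    by (elim exE conjE) blast
  from add(2) obtain q M where q:
    "\<And>k. polynomial_fun (\<lambda>w. coeff (q w) k)" "\<And>w. degree (q w) \<le> M" "\<And>w t. g (t *s w) = poly (q w) t"
    by (elim exE conjE) blast
  from p q show ?case
    by (intro exI[of _ "\<lambda>w. p w + q w"] exI[of _ "max N M"] conjI allI)
       (simp_all add: polynomial_fun_intros degree_add_le max.coboundedI1 max.coboundedI2)
next
  case (mult f g)
  from mult(1) obtain p N where p:
    "\<And>k. polynomial_fun (\<lambda>w. coeff (p w) k)" "\<And>w. degree (p w) \<le> N" "\<And>w t. f (t *s w) = poly (p w) t"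
    by (elim exE conjE) blast
  from mult(2) obtain q M where q:
    "\<And>k. polynomial_fun (\<lambda>w. coeff (q w) k)" "\<And>w. degree (q w) \<le> M" "\<And>w t. g (t *s w) = poly (q w) t"
    by (elim exE conjE) blast
  from p q show ?case
    by (intro exI[of _ "\<lambda>w. p w * q w"] exI[of _ "N + M"] conjI allI)
       (simp_all add: coeff_mult polynomial_fun_intros order_trans[OF degree_mult_le add_mono])
qed

section \<open>Identity theorem\<close>

lemma poly_eq_0_if_zero_on_open:
  fixes p :: "complex poly"
  assumes "open S" "S \<noteq> {}" "\<And>t. t \<in> S \<Longrightarrow> poly p t = 0"
  shows "p = 0"
proof (rule ccontr)
  assume "p \<noteq> 0"
  then have "finite {t. poly p t = 0}" by (rule poly_roots_finite)
  then have "finite S" by (rule finite_subset[rotated]) (use assms in auto)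
  then show False using assms(1,2) finite_imp_not_open by blast
qed

lemma poly_eq_if_eq_on_open:
  fixes p q :: "complex poly"
  assumes "open S" "S \<noteq> {}" "\<And>t. t \<in> S \<Longrightarrow> poly p t = poly q t"
  shows "p = q"
  using poly_eq_0_if_zero_on_open[of S "p - q"] assms by simp

text \<open>The line from a point of \<open>S\<close> to \<open>x\<close> stays in \<open>S\<close>
  near parameter 0, so \<open>f\<close> restricted to it is the zero polynomial; its value at
  parameter 1 is \<open>f x\<close>.\<close>

lemma polynomial_fun_eq_0_if_zero_on_open:
  assumes f: "polynomial_fun f" and S: "open S" "S \<noteq> {}" "\<And>x. x \<in> S \<Longrightarrow> f x = 0"
  shows "f x = 0"
proof -
  obtain a where a: "a \<in> S" using S by blast
  let ?c = "\<lambda>t. \<chi> i. poly [:a $ i, x $ i - a $ i:] t"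
  obtain q where q: "\<And>t. f (?c t) = poly q t"
    using polynomial_fun_curve[OF f, of "\<lambda>i. [:a $ i, x $ i - a $ i:]"] by blast
  have "continuous_on UNIV ?c" by (intro continuous_intros)
  then have "open (?c -` S)" using S(1) by (simp add: continuous_on_open_vimage)
  moreover have "?c 0 = a" "?c 1 = x" by (simp_all add: vec_eq_iff)
  moreover have "0 \<in> ?c -` S" using a \<open>?c 0 = a\<close> by simp
  ultimately have "q = 0"
    using S(3) q by (intro poly_eq_0_if_zero_on_open[of "?c -` S"]) fastforce+
  then show ?thesis using q[of 1] \<open>?c 1 = x\<close> by simp
qed

lemma open_polynomial_fun_nonzero:
  assumes "polynomial_fun f"
  shows "open {x. f x \<noteq> 0}"
  using continuous_on_polynomial_fun[OF assms, of UNIV]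
  by (simp add: open_Collect_neq continuous_on_const)

lemma polynomial_fun_mult_nonzero:
  assumes "polynomial_fun f" "polynomial_fun g" "\<exists>x. f x \<noteq> 0" "\<exists>x. g x \<noteq> 0"
  shows "\<exists>x. f x * g x \<noteq> 0"
proof (rule ccontr)
  assume "\<nexists>x. f x * g x \<noteq> 0"
  then have "g x = 0" if "x \<in> {x. f x \<noteq> 0}" for x
    using that by auto
  then have "g x = 0" for x
    using polynomial_fun_eq_0_if_zero_on_open[OF assms(2) open_polynomial_fun_nonzero[OF assms(1)]] assms(3)
    by blast
  then show False using assms(4) by blast
qed

lemma polynomial_fun_prod_nonzero:
  fixes f :: "'a \<Rightarrow> complex ^ 'n \<Rightarrow> complex"
  assumes "finite S" "\<And>a. a \<in> S \<Longrightarrow> polynomial_fun (f a)" "\<And>a. a \<in> S \<Longrightarrow> \<exists>x. f a x \<noteq> 0"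
  shows "\<exists>x. (\<Prod>a\<in>S. f a x) \<noteq> 0"
  using assms
proof (induction S rule: finite_induct)
  case (insert a S)
  then show ?case
    using polynomial_fun_mult_nonzero[of "f a" "\<lambda>x. \<Prod>a\<in>S. f a x"]
    by (auto intro: polynomial_fun_prod)
qed auto

subsection \<open>Algebraic dependence\<close>

text \<open>Gaussian elimination by induction on the equations: an unknown \<open>p\<close> with
  nonzero coefficient in equation \<open>j\<close> is the pivot, is eliminated from the other
  equations, and is finally recovered from equation \<open>j\<close>.\<close>

lemma homogeneous_system_nontrivial:
  fixes M :: "'a \<Rightarrow> 'b \<Rightarrow> 'c :: field"
  assumes "finite J" "finite I" "card J < card I"
  shows "\<exists>c. (\<exists>i\<in>I. c i \<noteq> 0) \<and> (\<forall>j\<in>J. (\<Sum>i\<in>I. c i * M i j) = 0)"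
  using assms
proof (induction J arbitrary: I M rule: finite_induct)
  case empty
  then obtain i where "i \<in> I" by fastforce
  then show ?case by (intro exI[of _ "\<lambda>_. 1"]) auto
next
  case (insert j J)
  show ?case
  proof (cases "\<forall>i\<in>I. M i j = 0")
    case True
    from insert.prems insert.hyps have "card J < card I" by simp
    from insert.IH[OF insert.prems(1) this, of M] obtain c where
      c: "\<exists>i\<in>I. c i \<noteq> 0" "\<And>j. j \<in> J \<Longrightarrow> (\<Sum>i\<in>I. c i * M i j) = 0" by blast
    have "(\<Sum>i\<in>I. c i * M i j) = 0" using True by simp
    with c show ?thesis by (intro exI[of _ c]) simp
  next
    case False
    then obtain p where p: "p \<in> I" "M p j \<noteq> 0" by blast
    let ?I = "I - {p}"
    define M' where "M' = (\<lambda>i k. M i k - M i j / M p j * M p k)"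
    have "card J < card ?I" using insert.prems insert.hyps p by simp
    with insert.IH[of ?I M'] insert.prems(1) obtain c' i where
      i: "i \<in> ?I" "c' i \<noteq> 0" and c': "\<And>k. k \<in> J \<Longrightarrow> (\<Sum>i\<in>?I. c' i * M' i k) = 0"
      by (metis finite_Diff)
    define s where "s = - (\<Sum>i\<in>?I. c' i * M i j) / M p j"
    define c where "c = c'(p := s)"
    have split: "(\<Sum>i\<in>I. c i * M i k) = s * M p k + (\<Sum>i\<in>?I. c' i * M i k)" for k
      using insert.prems(1) p(1) by (subst sum.remove[of _ p]) (auto simp: c_def)
    have "(\<Sum>i\<in>I. c i * M i j) = 0"
      unfolding split using p(2) by (simp add: s_def)
    moreover have "(\<Sum>i\<in>I. c i * M i k) = 0" if "k \<in> J" for k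
    proof -
      have "(\<Sum>i\<in>?I. c' i * M' i k)
        = (\<Sum>i\<in>?I. c' i * M i k - c' i * M i j * (M p k / M p j))"
        by (simp add: M'_def algebra_simps)
      also have "\<dots> = (\<Sum>i\<in>?I. c' i * M i k) - (\<Sum>i\<in>?I. c' i * M i j) * (M p k / M p j)"
        by (simp add: sum_subtractf sum_distrib_right sum_divide_distrib)
      also have "\<dots> = (\<Sum>i\<in>I. c i * M i k)"
        unfolding split by (simp add: s_def)
      finally show ?thesis using c'[OF that] by simp
    qed
    moreover have "c i \<noteq> 0" "i \<in> I" using i by (auto simp: c_def)
    ultimately show ?thesis by (intro exI[of _ c]) auto
  qed
qed

section \<open>Bounded partial degrees and independence of monomials\<close>

abbreviation monomial :: "('n \<Rightarrow> nat) \<Rightarrow> complex ^ 'n \<Rightarrow> complex" where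
  "monomial m x \<equiv> \<Prod>i\<in>UNIV. (x $ i) ^ m i"

text \<open>The bound is on each exponent, not on the total degree: the exponent vectors form a box,
  which is easy to count and splits off one coordinate at a time.\<close>

definition exponents :: "nat \<Rightarrow> ('n \<Rightarrow> nat) set" where
  "exponents d = {m. \<forall>i. m i \<le> d}"

definition degree_bounded :: "nat \<Rightarrow> (complex ^ 'n \<Rightarrow> complex) \<Rightarrow> bool" where
  "degree_bounded d f \<longleftrightarrow> (\<exists>c. \<forall>x. f x = (\<Sum>m\<in>exponents d. c m * monomial m x))"

lemma exponents_PiE: "exponents d = (PiE UNIV (\<lambda>_. {..d}) :: ('n \<Rightarrow> nat) set)"
  by (auto simp: exponents_def PiE_UNIV_domain)

lemma finite_exponents: "finite (exponents d :: ('n :: finite \<Rightarrow> nat) set)"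
  unfolding exponents_PiE by (rule finite_PiE) auto

lemma card_exponents: "card (exponents d :: ('n :: finite \<Rightarrow> nat) set) = (d + 1) ^ CARD('n)"
  unfolding exponents_PiE by (subst card_PiE) auto

lemma sum_PiE_insert:
  assumes "i \<notin> I"
  shows "(\<Sum>m\<in>PiE (insert i I) S. g m) = (\<Sum>y\<in>S i. \<Sum>m\<in>PiE I S. g (m(i := y)))"
proof -
  have "(\<Sum>m\<in>PiE (insert i I) S. g m) = (\<Sum>(y, m)\<in>S i \<times> PiE I S. g (m(i := y)))"
    unfolding PiE_insert_eq
    by (subst sum.reindex[OF inj_combinator[OF assms]]) (auto simp: case_prod_beta intro!: sum.cong)
  then show ?thesis by (simp add: sum.cartesian_product)
qed

text \<open>Induction on the set of variables: with the others fixed, the sum is a polynomial in the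
  new variable that vanishes everywhere, so each of its coefficients \<open>?S y\<close> vanishes,
  and the induction hypothesis applies to \<open>?S y\<close>.\<close>

lemma monomials_independent_PiE:
  fixes c :: "('n \<Rightarrow> nat) \<Rightarrow> complex"
  assumes "finite I" "\<And>x. (\<Sum>m\<in>PiE I (\<lambda>_. {..d}). c m * (\<Prod>i\<in>I. x i ^ m i)) = 0"
    and "m \<in> PiE I (\<lambda>_. {..d})"
  shows "c m = 0"
  using assms
proof (induction I arbitrary: c m rule: finite_induct)
  case empty
  then show ?case by simp
next
  case (insert i I)
  have "(\<Sum>m\<in>PiE I (\<lambda>_. {..d}). c (m(i := y)) * (\<Prod>j\<in>I. x j ^ m j)) = 0" if "y \<le> d" for x y
  proof -
    let ?S = "\<lambda>y. \<Sum>m\<in>PiE I (\<lambda>_. {..d}). c (m(i := y)) * (\<Prod>j\<in>I. x j ^ m j)"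
    have "(\<Sum>y\<le>d. ?S y * z ^ y) = 0" for z
    proof -
      have pr: "(\<Prod>j\<in>insert i I. (x(i := z)) j ^ (m(i := y)) j) = z ^ y * (\<Prod>j\<in>I. x j ^ m j)" for m y
      proof -
        have "(\<Prod>j\<in>I. (x(i := z)) j ^ (m(i := y)) j) = (\<Prod>j\<in>I. x j ^ m j)"
          by (rule prod.cong) (use insert.hyps in auto)
        then show ?thesis using insert.hyps by simp
      qed
      have "0 = (\<Sum>m\<in>PiE (insert i I) (\<lambda>_. {..d}). c m * (\<Prod>j\<in>insert i I. (x(i := z)) j ^ m j))"
        using insert.prems(1)[of "x(i := z)"] by simp
      also have "\<dots> = (\<Sum>y\<le>d. \<Sum>m\<in>PiE I (\<lambda>_. {..d}).
          c (m(i := y)) * (\<Prod>j\<in>insert i I. (x(i := z)) j ^ (m(i := y)) j))"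
        by (rule sum_PiE_insert[OF insert.hyps(2)])
      also have "\<dots> = (\<Sum>y\<le>d. ?S y * z ^ y)"
        unfolding pr by (simp add: sum_distrib_left sum_distrib_right mult_ac)
      finally show ?thesis by simp
    qed
    then show ?thesis using polyfun_eq_0[of ?S d] that by blast
  qed
  then have c0: "c (m'(i := y)) = 0" if "y \<le> d" "m' \<in> PiE I (\<lambda>_. {..d})" for m' y
    using insert.IH[of "\<lambda>m. c (m(i := y))"] that by blast
  obtain y m' where "y \<le> d" "m' \<in> PiE I (\<lambda>_. {..d})" "m = m'(i := y)"
    using insert.prems(2) unfolding PiE_insert_eq by auto
  with c0[of y m'] show ?case by (simp only:)
qed

lemma monomials_independent:
  fixes c :: "('n :: finite \<Rightarrow> nat) \<Rightarrow> complex"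
  assumes "\<And>x. (\<Sum>m\<in>exponents d. c m * monomial m x) = 0" "m \<in> exponents d"
  shows "c m = 0"
proof (rule monomials_independent_PiE[of UNIV c d])
  show "(\<Sum>m\<in>UNIV \<rightarrow>\<^sub>E {..d}. c m * (\<Prod>i\<in>UNIV. x i ^ m i)) = 0" for x
    using assms(1)[of "\<chi> i. x i"] by (simp add: exponents_PiE)
qed (use assms(2) in \<open>auto simp: exponents_PiE\<close>)

lemma degree_bounded_monomial:
  assumes "m \<in> exponents d"
  shows "degree_bounded d (\<lambda>x. c * monomial m x)"
  unfolding degree_bounded_def
  by (rule exI[of _ "\<lambda>k. if k = m then c else 0"])
     (use assms in \<open>simp add: if_distrib[of "\<lambda>a. a * _"] finite_exponents cong: if_cong\<close>)

lemma degree_bounded_add: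
  assumes "degree_bounded d f" "degree_bounded d g"
  shows "degree_bounded d (\<lambda>x. f x + g x)"
proof -
  from assms obtain c e where "\<forall>x. f x = (\<Sum>m\<in>exponents d. c m * monomial m x)"
    "\<forall>x. g x = (\<Sum>m\<in>exponents d. e m * monomial m x)"
    unfolding degree_bounded_def by blast
  then show ?thesis
    unfolding degree_bounded_def
    by (intro exI[of _ "\<lambda>m. c m + e m"]) (simp add: sum.distrib distrib_right)
qed

lemma degree_bounded_sum:
  assumes "\<And>a. a \<in> S \<Longrightarrow> degree_bounded d (f a)"
  shows "degree_bounded d (\<lambda>x. \<Sum>a\<in>S. f a x)"
proof -
  have 0: "degree_bounded d (\<lambda>_. 0)"
    unfolding degree_bounded_def by (rule exI[of _ "\<lambda>_. 0"]) simp
  show ?thesis using assms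
    by (induction S rule: infinite_finite_induct) (simp_all add: 0 degree_bounded_add)
qed

lemma degree_bounded_mono:
  assumes "degree_bounded d f" "d \<le> e"
  shows "degree_bounded e f"
proof -
  from assms(1) obtain c where "f = (\<lambda>x. \<Sum>m\<in>exponents d. c m * monomial m x)"
    unfolding degree_bounded_def by blast
  moreover have "m \<in> exponents e" if "m \<in> exponents d" for m :: "'a \<Rightarrow> nat"
    using that assms(2) order_trans unfolding exponents_def by blast
  ultimately show ?thesis
    by (simp only:) (intro degree_bounded_sum degree_bounded_monomial)
qed

lemma degree_bounded_mult:
  assumes "degree_bounded d f" "degree_bounded e g"
  shows "degree_bounded (d + e) (\<lambda>x. f x * g x)"
proof -
  from assms obtain c a where f: "\<And>x. f x = (\<Sum>m\<in>exponents d. c m * monomial m x)"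
    and g: "\<And>x. g x = (\<Sum>k\<in>exponents e. a k * monomial k x)"
    unfolding degree_bounded_def by blast
  have "(\<lambda>x. f x * g x) = (\<lambda>x. \<Sum>m\<in>exponents d. \<Sum>k\<in>exponents e. (c m * a k) * monomial (\<lambda>i. m i + k i) x)"
    unfolding f g sum_product power_add prod.distrib by (simp only: mult_ac)
  moreover have "(\<lambda>i. m i + k i) \<in> exponents (d + e)"
    if "m \<in> exponents d" "k \<in> exponents e" for m k :: "'a \<Rightarrow> nat"
    using that by (simp add: exponents_def add_mono)
  ultimately show ?thesis
    by (simp only:) (intro degree_bounded_sum degree_bounded_monomial)
qed

lemma degree_bounded_one: "degree_bounded d (\<lambda>_. 1)"
  using degree_bounded_monomial[of "\<lambda>_. 0" d 1] by (simp add: exponents_def)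

lemma degree_bounded_power:
  assumes "degree_bounded d f"
  shows "degree_bounded (k * d) (\<lambda>x. f x ^ k)"
  by (induction k) (simp_all add: degree_bounded_one degree_bounded_mult[OF assms])

lemma degree_bounded_prod:
  assumes "finite S" "\<And>a. a \<in> S \<Longrightarrow> degree_bounded d (f a)"
  shows "degree_bounded (card S * d) (\<lambda>x. \<Prod>a\<in>S. f a x)"
  using assms
  by (induction S rule: finite_induct) (simp_all add: degree_bounded_one degree_bounded_mult)

lemma polynomial_fun_imp_degree_bounded:
  assumes "polynomial_fun f"
  shows "\<exists>d. degree_bounded d f"
proof -
  from assms obtain M c where M: "finite M" and f: "f = (\<lambda>x. \<Sum>m\<in>M. c m * monomial m x)"
    unfolding polynomial_fun_def by blast
  have "m \<in> exponents (\<Sum>m\<in>M. \<Sum>i\<in>UNIV. m i)" if "m \<in> M" for m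
  proof -
    have "m i \<le> (\<Sum>i\<in>UNIV. m i)" for i by (rule member_le_sum) auto
    also have "\<dots> \<le> (\<Sum>m\<in>M. \<Sum>i\<in>UNIV. m i)"
      using that M by (intro member_le_sum[of m M "\<lambda>m. \<Sum>i\<in>UNIV. m i"]) auto
    finally show ?thesis by (simp add: exponents_def)
  qed
  then have "degree_bounded (\<Sum>m\<in>M. \<Sum>i\<in>UNIV. m i) f"
    unfolding f by (intro degree_bounded_sum degree_bounded_monomial)
  then show ?thesis ..
qed

lemma polynomial_fun_monomial_sum: "polynomial_fun (\<lambda>x. \<Sum>m\<in>S. c m * monomial m x)"
  by (intro polynomial_fun_sum polynomial_fun_monomial)

text \<open>Dimension count. The products \<open>f x ^ l * monomial m (F x)\<close> with
  \<open>l\<close> and all exponents at most \<open>M\<close> number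
  \<open>(M + 1) ^ (n + 1)\<close>, but lie in a space of dimension \<open>(E + 1) ^ n\<close> with
  \<open>E\<close> linear in \<open>M\<close>. For suitable \<open>M\<close> there is a linear
  relation; collecting the powers of \<open>f\<close> gives the claim.\<close>

theorem algebraic_dependence:
  fixes f :: "complex ^ 'n \<Rightarrow> complex" and F :: "complex ^ 'n \<Rightarrow> complex ^ 'n"
  assumes f: "polynomial_fun f" and F: "polynomial_map F"
  shows "\<exists>L a. (\<forall>l. polynomial_fun (a l)) \<and> (\<exists>l\<le>L. \<exists>w. a l w \<noteq> 0) \<and>
           (\<forall>x. (\<Sum>l\<le>L. a l (F x) * f x ^ l) = 0)"
proof -
  obtain d0 where d0: "degree_bounded d0 f"
    using polynomial_fun_imp_degree_bounded[OF f] by blast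
  have "\<forall>i. \<exists>d. degree_bounded d (\<lambda>x. F x $ i)"
    using F polynomial_fun_imp_degree_bounded unfolding polynomial_map_def by blast
  then obtain D where D: "\<And>i. degree_bounded (D i) (\<lambda>x. F x $ i)" by metis
  define d where "d = d0 + (\<Sum>i\<in>UNIV. D i)"
  have fd: "degree_bounded d f" using degree_bounded_mono[OF d0] by (simp add: d_def)
  have "D i \<le> (\<Sum>i\<in>UNIV. D i)" for i by (rule member_le_sum) auto
  then have Fd: "degree_bounded d (\<lambda>x. F x $ i)" for i
    using degree_bounded_mono[OF D[of i], of d] by (simp add: d_def trans_le_add2)
  define n where "n = CARD('n)"
  \<comment> \<open>\<open>K\<close> is chosen so that \<open>E + 1 \<le> K * (M + 1)\<close>; then
    \<open>M = K ^ n\<close> gives \<open>(E + 1) ^ n \<le> M * (M + 1) ^ n\<close>, which is below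
    \<open>(M + 1) ^ (n + 1)\<close>.\<close>
  define K where "K = d * (n + 1) + 1"
  define M where "M = K ^ n"
  define E where "E = M * d + n * (M * d)"
  have g: "degree_bounded E (\<lambda>x. f x ^ l * monomial m (F x))" if "l \<le> M" "m \<in> exponents M" for l m
  proof -
    have "degree_bounded (M * d) (\<lambda>x. f x ^ l)"
      by (rule degree_bounded_mono[OF degree_bounded_power[OF fd]]) (use that in simp)
    moreover have "degree_bounded (n * (M * d)) (\<lambda>x. monomial m (F x))"
      unfolding n_def
    proof (intro degree_bounded_prod)
      fix i
      show "degree_bounded (M * d) (\<lambda>x. F x $ i ^ m i)"
        by (rule degree_bounded_mono[OF degree_bounded_power[OF Fd]])
          (use that in \<open>simp add: exponents_def\<close>)
    qed simp
    ultimately show ?thesis unfolding E_def by (rule degree_bounded_mult)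
  qed
  then have "\<forall>lm\<in>{..M} \<times> exponents M. \<exists>c. \<forall>x. f x ^ fst lm * monomial (snd lm) (F x)
      = (\<Sum>k\<in>exponents E. c k * monomial k x)"
    unfolding degree_bounded_def by auto
  from bchoice[OF this] obtain c where "\<forall>lm\<in>{..M} \<times> exponents M. \<forall>x.
      f x ^ fst lm * monomial (snd lm) (F x) = (\<Sum>k\<in>exponents E. c lm k * monomial k x)" ..
  then have c: "f x ^ l * monomial m (F x) = (\<Sum>k\<in>exponents E. c (l, m) k * monomial k x)"
    if "l \<le> M" "m \<in> exponents M" for l m x
    using that by fastforce
  let ?I = "{..M} \<times> (exponents M :: ('n \<Rightarrow> nat) set)"
  have "(E + 1) ^ n < (M + 1) ^ (n + 1)"
  proof -
    have "E + 1 \<le> K * (M + 1)" unfolding E_def K_def by (simp add: algebra_simps)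
    then have "(E + 1) ^ n \<le> (K * (M + 1)) ^ n" by (rule power_mono) simp
    also have "\<dots> = M * (M + 1) ^ n" by (simp only: M_def power_mult_distrib)
    also have "\<dots> < (M + 1) ^ (n + 1)" by simp
    finally show ?thesis .
  qed
  then have "card (exponents E :: ('n \<Rightarrow> nat) set) < card ?I"
    by (simp add: card_cartesian_product card_exponents n_def)
  from homogeneous_system_nontrivial[OF finite_exponents _ this, of c]
  obtain b where b: "\<exists>i\<in>?I. b i \<noteq> 0" "\<And>k. k \<in> exponents E \<Longrightarrow> (\<Sum>i\<in>?I. b i * c i k) = 0"
    by (auto simp: finite_exponents)
  define a where "a = (\<lambda>l w. \<Sum>m\<in>exponents M. b (l, m) * monomial m w)"
  have "(\<Sum>l\<le>M. a l (F x) * f x ^ l) = 0" for x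
  proof -
    have "(\<Sum>l\<le>M. a l (F x) * f x ^ l)
        = (\<Sum>l\<le>M. \<Sum>m\<in>exponents M. b (l, m) * (f x ^ l * monomial m (F x)))"
      by (simp add: a_def sum_distrib_right sum_distrib_left mult_ac)
    also have "\<dots> = (\<Sum>l\<le>M. \<Sum>m\<in>exponents M. b (l, m) * (\<Sum>k\<in>exponents E. c (l, m) k * monomial k x))"
      by (intro sum.cong refl arg_cong2[of _ _ _ _ "(*)"] c) auto
    also have "\<dots> = (\<Sum>i\<in>?I. b i * (\<Sum>k\<in>exponents E. c i k * monomial k x))"
      by (simp only: sum.cartesian_product split_def prod.collapse)
    also have "\<dots> = (\<Sum>i\<in>?I. \<Sum>k\<in>exponents E. b i * (c i k * monomial k x))"
      by (simp only: sum_distrib_left)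
    also have "\<dots> = (\<Sum>k\<in>exponents E. (\<Sum>i\<in>?I. b i * c i k) * monomial k x)"
      by (subst sum.swap) (simp add: sum_distrib_right mult.assoc)
    also have "\<dots> = 0" using b(2) by simp
    finally show ?thesis .
  qed
  moreover have "polynomial_fun (a l)" for l
    unfolding a_def by (rule polynomial_fun_monomial_sum)
  \<comment> \<open>Some \<open>b (l, m)\<close> is nonzero, and monomials are independent, so this
    \<open>a l\<close> is not the zero function.\<close>
  moreover have "\<exists>l\<le>M. \<exists>w. a l w \<noteq> 0"
  proof (rule ccontr)
    assume *: "\<not> (\<exists>l\<le>M. \<exists>w. a l w \<noteq> 0)"
    from b(1) obtain l m where lm: "l \<le> M" "m \<in> exponents M" "b (l, m) \<noteq> 0" by auto
    have "b (l, m) = 0"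
      by (rule monomials_independent[of "\<lambda>m. b (l, m)" M]) (use * lm in \<open>auto simp: a_def\<close>)
    then show False using lm by simp
  qed
  ultimately show ?thesis by blast
qed

section \<open>Cauchy's root bound and multiples of controlled growth\<close>

lemma norm_root_le:
  fixes y :: complex
  assumes "M \<ge> 1" "y ^ M = - (\<Sum>l<M. h l * y ^ l)"
  shows "norm y \<le> 1 + (\<Sum>l<M. norm (h l))"
proof (cases "norm y \<le> 1")
  case True
  then show ?thesis using sum_nonneg[of "{..<M}" "\<lambda>l. norm (h l)"] by simp
next
  case False
  have "norm y ^ M = norm (\<Sum>l<M. h l * y ^ l)"
    using arg_cong[OF assms(2), of norm] by (simp add: norm_power)
  also have "\<dots> \<le> (\<Sum>l<M. norm (h l) * norm y ^ l)"
    by (rule order_trans[OF norm_sum]) (simp add: norm_mult norm_power)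
  also have "\<dots> \<le> (\<Sum>l<M. norm (h l) * norm y ^ (M - 1))"
    by (intro sum_mono mult_left_mono power_increasing) (use False in auto)
  finally have "norm y * norm y ^ (M - 1) \<le> (\<Sum>l<M. norm (h l)) * norm y ^ (M - 1)"
    using assms(1) by (simp add: sum_distrib_right power_eq_if[of _ M])
  moreover have "norm y ^ (M - 1) > 0" using False by (intro zero_less_power) linarith
  ultimately have "norm y \<le> (\<Sum>l<M. norm (h l))" by simp
  then show ?thesis by simp
qed

lemma polynomial_growth_sum:
  fixes h :: "'a \<Rightarrow> complex ^ 'n \<Rightarrow> real"
  assumes "finite S" "\<And>a. a \<in> S \<Longrightarrow> \<exists>C N. C \<ge> 0 \<and> (\<forall>x. h a x \<le> C * (1 + norm x) ^ N)"
  shows "\<exists>C N. C \<ge> 0 \<and> (\<forall>x. (\<Sum>a\<in>S. h a x) \<le> C * (1 + norm x) ^ N)"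
  using assms
proof (induction S rule: finite_induct)
  case empty
  show ?case by (rule exI[of _ 0]) simp
next
  case (insert a S)
  from insert.prems[of a] obtain C N where C: "C \<ge> 0" "\<And>x. h a x \<le> C * (1 + norm x) ^ N" by auto
  from insert.IH insert.prems obtain D M where
    D: "D \<ge> 0" "\<And>x. (\<Sum>a\<in>S. h a x) \<le> D * (1 + norm x) ^ M" by (meson insertCI)
  have "(\<Sum>a\<in>insert a S. h a x) \<le> (C + D) * (1 + norm x) ^ (max N M)" for x
  proof -
    have "C * (1 + norm x) ^ N \<le> C * (1 + norm x) ^ (max N M)"
      "D * (1 + norm x) ^ M \<le> D * (1 + norm x) ^ (max N M)"
      using C(1) D(1) by (auto intro!: mult_left_mono power_increasing)
    then show ?thesis using C(2)[of x] D(2)[of x] insert.hyps by (simp add: algebra_simps)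
  qed
  then show ?case using C(1) D(1) by (intro exI[of _ "C + D"] exI[of _ "max N M"]) auto
qed

text \<open>Multiplied by \<open>a M (F x) ^ (M - 1)\<close>, the algebraic relation with leading
  coefficient \<open>a M\<close> becomes monic in \<open>a M (F x) * f x\<close>, with coefficients
  polynomial in \<open>F x\<close>. Cauchy's bound for its roots gives the growth estimate.\<close>

lemma integral_multiple_growth:
  fixes F :: "complex ^ 'n \<Rightarrow> complex ^ 'n"
  assumes f: "polynomial_fun f" and F: "polynomial_map F" "open (range F)"
  shows "\<exists>c C N. polynomial_fun c \<and> (\<exists>w. c w \<noteq> 0) \<and> C \<ge> 0 \<and>
           (\<forall>x. norm (c (F x) * f x) \<le> C * (1 + norm (F x)) ^ N)"
proof -
  from algebraic_dependence[OF f F(1)] obtain L a where a: "\<And>l. polynomial_fun (a l)"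
    and nz: "\<exists>l\<le>L. \<exists>w. a l w \<noteq> 0" and rel: "\<And>x. (\<Sum>l\<le>L. a l (F x) * f x ^ l) = 0" by blast
  \<comment> \<open>\<open>M\<close> is the top index whose coefficient is not identically zero; the
    higher terms drop out of the relation.\<close>
  define R where "R = (\<lambda>l. l \<le> L \<and> (\<exists>w. a l w \<noteq> 0))"
  define M where "M = Greatest R"
  have "\<exists>l. R l" "\<And>l. R l \<Longrightarrow> l \<le> L" using nz unfolding R_def by blast+
  then have "R M" and max: "\<And>l. R l \<Longrightarrow> l \<le> M"
    unfolding M_def by (blast intro: GreatestI_nat, blast intro: Greatest_le_nat)
  then have M: "M \<le> L" "\<exists>w. a M w \<noteq> 0" by (auto simp: R_def)
  have rel': "(\<Sum>l\<le>M. a l (F x) * f x ^ l) = 0" for x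
  proof -
    have "(\<Sum>l\<le>M. a l (F x) * f x ^ l) = (\<Sum>l\<le>L. a l (F x) * f x ^ l)"
    proof (rule sum.mono_neutral_left)
      show "\<forall>l\<in>{..L} - {..M}. a l (F x) * f x ^ l = 0" using max unfolding R_def by force
    qed (use M in auto)
    then show ?thesis using rel by simp
  qed
  \<comment> \<open>For \<open>M = 0\<close> the relation would make \<open>a M\<close> vanish on
    the open set \<open>range F\<close>, hence everywhere.\<close>
  have "M \<noteq> 0"
  proof
    assume "M = 0"
    then have "a M w = 0" if "w \<in> range F" for w using rel' that by auto
    then show False using polynomial_fun_eq_0_if_zero_on_open[OF a F(2), of M] M(2) by blast
  qed
  define h where "h = (\<lambda>l w. a l w * a M w ^ (M - 1 - l))"
  have "polynomial_fun (h l)" for l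
    unfolding h_def by (intro polynomial_fun_mult polynomial_fun_power a)
  then have "\<exists>C N. C \<ge> 0 \<and> (\<forall>w. (\<Sum>l<M. norm (h l w)) \<le> C * (1 + norm w) ^ N)"
    by (intro polynomial_growth_sum polynomial_fun_growth) simp
  then obtain C N where C: "C \<ge> 0" "\<And>w. (\<Sum>l<M. norm (h l w)) \<le> C * (1 + norm w) ^ N" by blast
  have "norm (a M (F x) * f x) \<le> (1 + C) * (1 + norm (F x)) ^ N" for x
  proof -
    let ?y = "a M (F x) * f x"
    have "?y ^ M = a M (F x) ^ (M - 1) * (a M (F x) * f x ^ M)"
      using \<open>M \<noteq> 0\<close> by (simp add: power_mult_distrib power_eq_if[of _ M])
    also have "a M (F x) * f x ^ M = - (\<Sum>l<M. a l (F x) * f x ^ l)"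
      using rel'[of x] by (simp add: lessThan_Suc_atMost[symmetric] add_eq_0_iff)
    also have "a M (F x) ^ (M - 1) * - (\<Sum>l<M. a l (F x) * f x ^ l)
        = - (\<Sum>l<M. a M (F x) ^ (M - 1) * (a l (F x) * f x ^ l))"
      by (simp add: sum_distrib_left)
    also have "(\<Sum>l<M. a M (F x) ^ (M - 1) * (a l (F x) * f x ^ l)) = (\<Sum>l<M. h l (F x) * ?y ^ l)"
    proof (rule sum.cong[OF refl])
      fix l assume "l \<in> {..<M}"
      then have "M - 1 = (M - 1 - l) + l" by auto
      then have "a M (F x) ^ (M - 1) = a M (F x) ^ (M - 1 - l) * a M (F x) ^ l"
        by (metis power_add)
      then show "a M (F x) ^ (M - 1) * (a l (F x) * f x ^ l) = h l (F x) * ?y ^ l"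
        by (simp add: h_def power_mult_distrib)
    qed
    finally have "norm ?y \<le> 1 + (\<Sum>l<M. norm (h l (F x)))"
      using \<open>M \<noteq> 0\<close> by (intro norm_root_le) auto
    also have "\<dots> \<le> 1 * (1 + norm (F x)) ^ N + C * (1 + norm (F x)) ^ N"
      using C(2)[of "F x"] by (intro add_mono) (auto intro: one_le_power)
    finally show ?thesis by (simp add: algebra_simps)
  qed
  then show ?thesis
    using a[of M] M(2) C(1) by (intro exI[of _ "a M"] exI[of _ "1 + C"] exI[of _ N]) auto
qed

text \<open>Let \<open>a m\<close> be the lowest coefficient of the algebraic relation that is not
  identically zero. Cancelling \<open>f x ^ m\<close> leaves the constant term
  \<open>a m (F x)\<close>, which must vanish wherever \<open>f\<close> does. The application is to
  the Jacobian determinant.\<close>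

lemma nonvanishing_off_hypersurface:
  fixes F :: "complex ^ 'n \<Rightarrow> complex ^ 'n"
  assumes f: "polynomial_fun f" "\<exists>x. f x \<noteq> 0" and F: "polynomial_map F"
  shows "\<exists>c. polynomial_fun c \<and> (\<exists>w. c w \<noteq> 0) \<and> (\<forall>x. c (F x) \<noteq> 0 \<longrightarrow> f x \<noteq> 0)"
proof -
  from algebraic_dependence[OF f(1) F] obtain L a where a: "\<And>l. polynomial_fun (a l)"
    and nz: "\<exists>l\<le>L. \<exists>w. a l w \<noteq> 0" and rel: "\<And>x. (\<Sum>l\<le>L. a l (F x) * f x ^ l) = 0" by blast
  define m where "m = (LEAST l. l \<le> L \<and> (\<exists>w. a l w \<noteq> 0))"
  have m: "m \<le> L" "\<exists>w. a m w \<noteq> 0"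
    using LeastI_ex[OF nz[unfolded], folded m_def] by auto
  have min: "a l w = 0" if "l < m" for l w
    using not_less_Least[of l "\<lambda>l. l \<le> L \<and> (\<exists>w. a l w \<noteq> 0)"] that m(1) by (auto simp: m_def)
  define h where "h = (\<lambda>x. \<Sum>k\<le>L - m. a (k + m) (F x) * f x ^ k)"
  have h: "polynomial_fun h"
    unfolding h_def by (intro polynomial_fun_intros f polynomial_fun_compose[OF a F])
  have "f x ^ m * h x = 0" for x
  proof -
    have "f x ^ m * h x = (\<Sum>k\<le>L - m. a (k + m) (F x) * f x ^ (k + m))"
      by (simp add: h_def sum_distrib_left power_add mult_ac)
    also have "\<dots> = (\<Sum>l\<in>{m..L}. a l (F x) * f x ^ l)"
      by (rule sum.reindex_bij_witness[of _ "\<lambda>l. l - m" "\<lambda>k. k + m"]) (use m(1) in auto)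
    also have "\<dots> = (\<Sum>l\<le>L. a l (F x) * f x ^ l)"
      by (rule sum.mono_neutral_left) (auto simp: min)
    finally show ?thesis using rel by simp
  qed
  \<comment> \<open>\<open>h\<close> vanishes on the nonempty open set where \<open>f\<close> does
    not, hence also at the zeros of \<open>f\<close>, where it is needed.\<close>
  then have "h x = 0" for x
    using polynomial_fun_eq_0_if_zero_on_open[OF h open_polynomial_fun_nonzero[OF f(1)]] f(2)
    by fastforce
  then have "f x \<noteq> 0" if "a m (F x) \<noteq> 0" for x
  proof -
    have "h x = a m (F x)" if "f x = 0"
      using that by (simp add: h_def power_0_left if_distrib cong: if_cong)
    then show ?thesis using \<open>\<And>x. h x = 0\<close> that by metis
  qed
  then show ?thesis using a m(2) by blast
qed

subsection \<open>Bivariate polynomials\<close>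

text \<open>Take a nonzero \<open>h\<close> of least degree in the ideal of \<open>D\<close> and
  \<open>P\<close>. Pseudo-remainders modulo \<open>h\<close> lie in the ideal, so they vanish; by
  Gauss's lemma the primitive part of \<open>h\<close> divides \<open>D\<close> and \<open>P\<close>
  and is a unit. Over \<open>complex poly\<close> the constant \<open>e\<close> is a polynomial in
  \<open>s\<close> alone.\<close>

lemma coprime_imp_bezout_const:
  fixes D P :: "'a :: {factorial_ring_gcd, semiring_gcd_mult_normalize} poly"
  assumes "coprime D P"
  shows "\<exists>u v e. e \<noteq> 0 \<and> u * D + v * P = [:e:]"
proof -
  let ?S = "\<lambda>h. h \<noteq> 0 \<and> (\<exists>u v. u * D + v * P = h)"
  have "1 * D + 0 * P = D" "0 * D + 1 * P = P" by simp_all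
  then have "?S D \<or> ?S P" using assms by fastforce
  then have "\<exists>h. ?S h" by blast
  then obtain h where h: "?S h" and min: "\<And>h'. ?S h' \<Longrightarrow> degree h \<le> degree h'"
    using ex_has_least_nat[of ?S _ degree] by blast
  from h obtain u v where uv: "u * D + v * P = h" by blast
  have dvd: "primitive_part h dvd f" if f: "f = D \<or> f = P" for f
  proof -
    obtain c q where c: "c \<noteq> 0" "smult c f = h * q + pseudo_mod f h"
      using pseudo_mod(1)[of h f] h by blast
    have r: "pseudo_mod f h = smult c f - q * (u * D + v * P)" using c(2) uv by (simp add: mult.commute)
    have "\<exists>u' v'. u' * D + v' * P = pseudo_mod f h"
    proof (cases "f = D")
      case True
      then have "([:c:] - q * u) * D + (- q * v) * P = pseudo_mod f h"
        unfolding r by (simp add: algebra_simps)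
      then show ?thesis by blast
    next
      case False
      then have "f = P" using f by simp
      then have "(- q * u) * D + ([:c:] - q * v) * P = pseudo_mod f h"
        unfolding r by (simp add: algebra_simps)
      then show ?thesis by blast
    qed
    then have *: "pseudo_mod f h = 0 \<or> degree h \<le> degree (pseudo_mod f h)" using min by blast
    show ?thesis
    proof (cases "pseudo_mod f h = 0")
      case True
      then have "h dvd smult c f" using c(2) by simp
      moreover have "primitive_part h dvd smult (content h) (primitive_part h)"
        by (rule dvd_smult) (rule dvd_refl)
      then have "primitive_part h dvd h" by simp
      ultimately have "primitive_part h dvd smult c f" by (rule dvd_trans[rotated])
      from fract_poly_dvd[OF this]
      have "fract_poly (primitive_part h) dvd smult (to_fract c) (fract_poly f)"
        by (simp only: fract_poly_smult)
      then have "fract_poly (primitive_part h) dvd fract_poly f"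
        by (rule dvd_smult_cancel) (use c(1) in simp)
      then show ?thesis using h by (intro fract_poly_dvdD) auto
    next
      case False
      then have "degree (pseudo_mod f h) < degree h" using pseudo_mod(2)[of h f] h by blast
      then show ?thesis using * False by simp
    qed
  qed
  have "is_unit (primitive_part h)"
    by (rule coprime_common_divisor[OF assms]) (simp_all add: dvd)
  then obtain c where "primitive_part h = [:c:]" unfolding is_unit_poly_iff by blast
  then have "degree (primitive_part h) = 0" by (metis degree_pCons_0)
  then have "degree h = 0" by simp
  then obtain e where "h = [:e:]" by (meson degree_eq_zeroE)
  then show ?thesis using h uv by (intro exI[of _ u] exI[of _ v] exI[of _ e]) auto
qed

text \<open>Elements of \<^typ>\<open>complex poly poly\<close> are polynomials in $t$ whose coefficients are
  polynomials in $s$; \<open>spec s\<close> substitutes a value for $s$.\<close>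

definition spec :: "complex \<Rightarrow> complex poly poly \<Rightarrow> complex poly" where
  "spec s Q = map_poly (\<lambda>p. poly p s) Q"

lemma coeff_spec: "coeff (spec s Q) k = poly (coeff Q k) s"
  by (simp add: spec_def coeff_map_poly)

lemma spec_0 [simp]: "spec s 0 = 0"
  by (rule poly_eqI) (simp add: coeff_spec)

lemma spec_add [simp]: "spec s (P + Q) = spec s P + spec s Q"
  by (rule poly_eqI) (simp add: coeff_spec)

lemma spec_mult [simp]: "spec s (P * Q) = spec s P * spec s Q"
  by (rule poly_eqI) (simp add: coeff_spec coeff_mult poly_sum)

lemma spec_pCons [simp]: "spec s (pCons p Q) = pCons (poly p s) (spec s Q)"
  by (rule poly_eqI) (simp add: coeff_spec coeff_pCons split: nat.split)

lemma degree_spec_le: "degree (spec s Q) \<le> degree Q"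
  by (rule degree_le) (simp add: coeff_spec coeff_eq_0)

text \<open>Evaluating at \<open>t\<close> first leaves a polynomial in \<open>s\<close>, to which
  the fundamental theorem of algebra can be applied.\<close>

lemma poly_spec_swap: "poly (spec s Q) t = poly (poly Q [:t:]) s"
  by (induction Q) auto

lemma continuous_on_spec:
  assumes "continuous_on X f" "continuous_on X g"
  shows "continuous_on X (\<lambda>x. poly (spec (f x) Q) (g x))"
  by (induction Q) (auto intro!: continuous_intros assms)

lemma uniform_limit_spec:
  assumes "compact K" "s \<longlonglongrightarrow> s0"
  shows "uniform_limit K (\<lambda>n t. poly (spec (s n) Q) t) (\<lambda>t. poly (spec s0 Q) t) sequentially"
proof (induction Q)
  case 0
  show ?case by (simp add: uniform_limit_const)
next
  case (pCons p Q)
  have "(\<lambda>n. poly p (s n)) \<longlonglongrightarrow> poly p s0" by (intro tendsto_intros assms)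
  then have 1: "uniform_limit K (\<lambda>n t. poly p (s n)) (\<lambda>t. poly p s0) sequentially"
    by (auto simp: uniform_limit_iff tendsto_iff elim!: eventually_mono)
  have "bounded ((\<lambda>t. poly (spec s0 Q) t) ` K)" "bounded ((\<lambda>t. t) ` K)"
    using assms(1) by (auto intro!: compact_imp_bounded compact_continuous_image continuous_intros)
  then have "uniform_limit K (\<lambda>n t. t * poly (spec (s n) Q) t) (\<lambda>t. t * poly (spec s0 Q) t) sequentially"
    by (intro uniform_lim_mult uniform_limit_const pCons.IH) auto
  with 1 show ?case by (simp add: uniform_limit_add)
qed

text \<open>As \<open>s\<close> tends to \<open>s0\<close>, the slices of \<open>D\<close> converge
  uniformly on compact sets and have no zeros near \<open>t0\<close>. By Hurwitz's theorem a
  nonconstant limit has none either; a constant limit is nonzero by hypothesis.\<close>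

lemma spec_nonzero_by_Hurwitz:
  assumes "spec s0 D \<noteq> 0" "\<epsilon> > 0"
    and nz: "\<And>s t. s \<in> ball s0 \<epsilon> - {s0} \<Longrightarrow> t \<in> ball t0 \<epsilon> \<Longrightarrow> poly (spec s D) t \<noteq> 0"
  shows "poly (spec s0 D) t0 \<noteq> 0"
proof (cases "(\<lambda>t. poly (spec s0 D) t) constant_on ball t0 \<epsilon>")
  case True
  then obtain c where c: "\<And>t. t \<in> ball t0 \<epsilon> \<Longrightarrow> poly (spec s0 D) t = c"
    unfolding constant_on_def by blast
  then have "spec s0 D = [:c:]"
    by (intro poly_eq_if_eq_on_open[of "ball t0 \<epsilon>"]) (use assms(2) in auto)
  then show ?thesis using assms(1) by auto
next
  case False
  \<comment> \<open>The summand 2 keeps even the first term strictly inside the ball.\<close>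
  define s where "s = (\<lambda>n. s0 + complex_of_real (\<epsilon> / (real n + 2)))"
  have "(\<lambda>n. complex_of_real (\<epsilon> / (real n + 2))) \<longlonglongrightarrow> of_real 0"
    by (intro tendsto_of_real) real_asymp
  then have lim: "s \<longlonglongrightarrow> s0 + 0" unfolding s_def by (intro tendsto_add tendsto_const) simp
  have sb: "s n \<in> ball s0 \<epsilon> - {s0}" for n
  proof -
    define r where "r = \<epsilon> / (real n + 2)"
    have "r < \<epsilon>" "r > 0" using assms(2) by (simp_all add: r_def divide_less_eq)
    moreover have "s n - s0 = of_real r" by (simp add: s_def r_def)
    ultimately show ?thesis by (auto simp: dist_norm norm_minus_commute[of s0])
  qed
  show ?thesis
  proof (rule Hurwitz_no_zeros[of "ball t0 \<epsilon>" "\<lambda>n t. poly (spec (s n) D) t" "\<lambda>t. poly (spec s0 D) t"])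
    show "uniform_limit K (\<lambda>n t. poly (spec (s n) D) t) (\<lambda>t. poly (spec s0 D) t) sequentially"
      if "compact K" for K
      using uniform_limit_spec[OF that] lim by simp
    show "poly (spec (s n) D) t \<noteq> 0" if "t \<in> ball t0 \<epsilon>" for n t
      using nz[OF sb that] .
  qed (use False assms(2) in \<open>auto intro!: holomorphic_intros\<close>)
qed

text \<open>The leading coefficient in \<open>t\<close> is a nonzero polynomial in \<open>s\<close>;
  away from its roots the slice is a nonzero polynomial in \<open>t\<close>.\<close>

lemma spec_nonzero_dense:
  assumes "Q \<noteq> 0" "open \<Omega>" "(s, t) \<in> \<Omega>"
  shows "\<exists>s' t'. (s', t') \<in> \<Omega> \<and> poly (spec s' Q) t' \<noteq> 0"
proof -
  obtain A B where AB: "open A" "open B" "s \<in> A" "t \<in> B" "A \<times> B \<subseteq> \<Omega>"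
    using open_prod_elim[OF assms(2,3)] by (metis SigmaE2)
  have "lead_coeff Q \<noteq> 0" using assms(1) by simp
  then obtain s' where s': "s' \<in> A" "poly (lead_coeff Q) s' \<noteq> 0"
    using poly_eq_0_if_zero_on_open[of A "lead_coeff Q"] AB by blast
  then have "spec s' Q \<noteq> 0" by (metis coeff_spec coeff_0)
  then obtain t' where "t' \<in> B" "poly (spec s' Q) t' \<noteq> 0"
    using poly_eq_0_if_zero_on_open[of B "spec s' Q"] AB by blast
  then show ?thesis using s' AB by blast
qed

lemma nonvanishing_poly_const:
  fixes p :: "complex poly"
  assumes "\<And>z. poly p z \<noteq> 0"
  shows "poly p x = poly p y"
proof -
  have "degree p = 0"
  proof (rule ccontr)
    assume "degree p \<noteq> 0"
    then have "\<exists>i\<in>{1..degree p}. coeff p i \<noteq> 0"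
      by (intro bexI[of _ "degree p"]) auto
    then obtain z where "(\<Sum>i\<le>degree p. coeff p i * z ^ i) = 0"
      using fundamental_theorem_of_algebra[of "coeff p" "degree p"] by auto
    then show False using assms[of z] by (simp add: poly_altdef)
  qed
  then obtain c where "p = [:c:]" by (meson degree_eq_zeroE)
  then show ?thesis by simp
qed

lemma polynomial_fun_bivariate:
  assumes "polynomial_fun f"
  shows "\<exists>Q. \<forall>s t. f (\<chi> i. poly (spec s (u i)) t) = poly (spec s Q) t"
  using assms
proof (induction rule: polynomial_fun_induct)
  case (const c)
  show ?case by (rule exI[of _ "[:[:c:]:]"]) simp
next
  case (coord i)
  show ?case by (rule exI[of _ "u i"]) simp
next
  case (add f g)
  then obtain P Q where "\<forall>s t. f (\<chi> i. poly (spec s (u i)) t) = poly (spec s P) t"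
    "\<forall>s t. g (\<chi> i. poly (spec s (u i)) t) = poly (spec s Q) t" by blast
  then show ?case by (intro exI[of _ "P + Q"]) simp
next
  case (mult f g)
  then obtain P Q where "\<forall>s t. f (\<chi> i. poly (spec s (u i)) t) = poly (spec s P) t"
    "\<forall>s t. g (\<chi> i. poly (spec s (u i)) t) = poly (spec s Q) t" by blast
  then show ?case by (intro exI[of _ "P * Q"]) simp
qed

lemma spec_sum: "spec s (\<Sum>a\<in>S. f a) = (\<Sum>a\<in>S. spec s (f a))"
  by (induction S rule: infinite_finite_induct) auto

lemma spec_monom: "spec s (monom p k) = monom (poly p s) k"
  by (rule poly_eqI) (simp add: coeff_spec)

subsection \<open>Functions that are rational on rays\<close>

lemma continuous_on_smult_vec:
  assumes "continuous_on S f" "continuous_on S g"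
  shows "continuous_on S (\<lambda>x. f x *s g x :: complex ^ 'n)"
  unfolding vector_scalar_mult_def using assms by (intro continuous_intros)

text \<open>Here \<open>g\<close> stands for a coordinate of the inverse of \<open>F\<close>,
  \<open>a\<close> for a denominator and \<open>b k\<close> for the coefficients of the numerator
  along rays. All rays share the same polynomial functions \<open>a\<close>, \<open>b k\<close> and
  the same bound \<open>N\<close>.\<close>

locale rational_on_rays =
  fixes F :: "complex ^ 'n \<Rightarrow> complex ^ 'n" and g a :: "complex ^ 'n \<Rightarrow> complex"
    and b :: "nat \<Rightarrow> complex ^ 'n \<Rightarrow> complex" and N :: nat
  assumes F: "polynomial_map F" and F0: "F 0 = 0" and open_range: "open (range F)"
    and cont_g: "continuous_on (range F) g"
    and a: "polynomial_fun a" and b: "\<And>k. polynomial_fun (b k)"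
    and a_g: "\<And>w t \<tau>. a (\<tau> *s w) \<noteq> 0 \<Longrightarrow> t *s w \<in> range F \<Longrightarrow>
      a (t *s w) * g (t *s w) = (\<Sum>k\<le>N. b k w * t ^ k)"
begin

definition regular :: "complex ^ 'n \<Rightarrow> bool" where
  "regular w \<longleftrightarrow> (\<exists>\<tau>. a (\<tau> *s w) \<noteq> 0)"

text \<open>The denominator of \<open>g\<close> along the ray in lowest terms, unique up to a
  constant factor by \<open>denominator_dvd\<close>. The equation is imposed only over
  \<open>range F\<close>, where \<open>g\<close> is controlled.\<close>

definition denominator :: "complex ^ 'n \<Rightarrow> complex poly \<Rightarrow> bool" where
  "denominator w d \<longleftrightarrow> d \<noteq> 0 \<and> (\<exists>q. coprime d q \<and>
     (\<forall>t. t *s w \<in> range F \<longrightarrow> poly d t * g (t *s w) = poly q t))"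

lemma open_ray: "open {t. t *s w \<in> range F}"
proof -
  have "continuous_on UNIV (\<lambda>t. t *s w)" by (intro continuous_on_smult_vec continuous_intros)
  then show ?thesis using open_range by (simp add: continuous_on_open_vimage vimage_def)
qed

lemma zero_in_ray: "0 *s w \<in> range F"
  using F0 by (metis rangeI vector_smult_lzero)

lemma ray_nonempty: "{t. t *s w \<in> range F} \<noteq> {}"
  using zero_in_ray by blast

text \<open>By continuity of \<open>g\<close>, a violation at \<open>t\<close> persists on a
  nonempty open set, and there \<open>\<gamma>\<close> would have to vanish.\<close>

lemma cancel_factor:
  assumes "\<gamma> \<noteq> 0"
    and "\<And>t. t *s w \<in> range F \<Longrightarrow> poly \<gamma> t * (poly d t * g (t *s w) - poly q t) = 0"
    and "t *s w \<in> range F"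
  shows "poly d t * g (t *s w) = poly q t"
proof (rule ccontr)
  assume *: "poly d t * g (t *s w) \<noteq> poly q t"
  let ?T = "{t. t *s w \<in> range F}"
  define h where "h = (\<lambda>t. poly d t * g (t *s w) - poly q t)"
  have "continuous_on ?T (\<lambda>t. t *s w)" by (intro continuous_on_smult_vec continuous_intros)
  then have "continuous_on ?T (\<lambda>t. g (t *s w))"
    by (rule continuous_on_compose2[OF cont_g]) auto
  then have "continuous_on ?T h" unfolding h_def by (intro continuous_intros)
  then have "open (?T \<inter> h -` (- {0}))"
    by (rule continuous_open_preimage) (use open_ray in auto)
  moreover have "t \<in> ?T \<inter> h -` (- {0})" using * assms(3) by (auto simp: h_def)
  ultimately have "\<gamma> = 0"
    by (intro poly_eq_0_if_zero_on_open[of "?T \<inter> h -` (- {0})"]) (use assms(2) in \<open>auto simp: h_def\<close>)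
  then show False using assms(1) by simp
qed

text \<open>Dividing \<open>a\<close> on the ray and its numerator by their gcd leaves a denominator
  that divides \<open>a\<close> on the ray, whose degree is bounded uniformly in
  \<open>w\<close>.\<close>

lemma denominator_exists:
  "\<exists>J. \<forall>w. regular w \<longrightarrow> (\<exists>d. denominator w d \<and> degree d \<le> J)"
proof -
  from polynomial_fun_ray[OF a] obtain \<alpha> J where
    \<alpha>: "\<And>w. degree (\<alpha> w) \<le> J" "\<And>w t. a (t *s w) = poly (\<alpha> w) t" by blast
  have "\<exists>d. denominator w d \<and> degree d \<le> J" if w: "regular w" for w
  proof -
    define p where "p = (\<Sum>k\<le>N. monom (b k w) k)"
    have p: "poly p t = (\<Sum>k\<le>N. b k w * t ^ k)" for t
      by (simp add: p_def poly_sum poly_monom)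
    have \<alpha>0: "\<alpha> w \<noteq> 0" using w \<alpha>(2) unfolding regular_def by force
    then have "gcd (\<alpha> w) p \<noteq> 0" by simp
    then obtain d q where d: "\<alpha> w = d * gcd (\<alpha> w) p" "p = q * gcd (\<alpha> w) p" "coprime d q"
      using gcd_coprime_exists by blast
    have "d \<noteq> 0" using d(1) \<alpha>0 by auto
    moreover have "poly d t * g (t *s w) = poly q t" if "t *s w \<in> range F" for t
    proof (rule cancel_factor[OF \<open>gcd (\<alpha> w) p \<noteq> 0\<close> _ that])
      fix t assume t: "t *s w \<in> range F"
      from w obtain \<tau> where "a (\<tau> *s w) \<noteq> 0" unfolding regular_def by blast
      from a_g[OF this t] have "poly (\<alpha> w) t * g (t *s w) = poly p t"
        by (simp only: p \<alpha>(2))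
      then have "poly (d * gcd (\<alpha> w) p) t * g (t *s w) = poly (q * gcd (\<alpha> w) p) t"
        by (simp only: d(1,2)[symmetric])
      then show "poly (gcd (\<alpha> w) p) t * (poly d t * g (t *s w) - poly q t) = 0"
        by (simp add: algebra_simps)
    qed
    moreover have "degree d \<le> J"
    proof -
      have "d dvd \<alpha> w" using d(1) by (metis dvd_triv_left)
      then show ?thesis using dvd_imp_degree_le \<alpha>0 \<alpha>(1) order_trans by blast
    qed
    ultimately show ?thesis unfolding denominator_def using d(3) by blast
  qed
  then show ?thesis by blast
qed

text \<open>Cross-multiplying two representations of \<open>g\<close> gives an identity on an open
  set of parameters, hence of polynomials; coprimality then yields divisibility.\<close>

lemma denominator_dvd:
  assumes "denominator w d" and "\<And>t. t *s w \<in> range F \<Longrightarrow> poly d' t * g (t *s w) = poly q' t"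
  shows "d dvd d'"
proof -
  obtain q where q: "coprime d q" "\<And>t. t *s w \<in> range F \<Longrightarrow> poly d t * g (t *s w) = poly q t"
    using assms(1) unfolding denominator_def by blast
  have "d * q' = d' * q"
  proof (rule poly_eq_if_eq_on_open[OF open_ray ray_nonempty])
    fix t assume "t \<in> {t. t *s w \<in> range F}"
    then have t: "t *s w \<in> range F" by simp
    show "poly (d * q') t = poly (d' * q) t"
      using assms(2)[OF t, symmetric] q(2)[OF t, symmetric] by simp
  qed
  then have "d dvd d' * q" by (metis dvd_triv_left)
  then show ?thesis using q(1) by (simp add: coprime_dvd_mult_left_iff)
qed

text \<open>The ray through \<open>w\<close> is the member \<open>s = 1\<close> of a family of rays
  that all meet \<open>range F\<close> at parameter \<open>t0\<close>. The values of the family's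
  denominator \<open>D\<close> are compared along the path \<open>(1, t0)\<close>,
  \<open>(0, t0)\<close>, \<open>(0, 0)\<close>, \<open>(1, 0)\<close> in the \<open>(s, t)\<close>
  plane, each leg being a line on which \<open>D\<close> has no zeros.\<close>

lemma denominator_const_if_max_degree:
  assumes w: "regular w" "denominator w d"
    and max: "\<And>w' d'. regular w' \<Longrightarrow> denominator w' d' \<Longrightarrow> degree d' \<le> degree d"
    and t0: "t0 *s w = F x0"
  shows "poly d t0 = poly d 0"
proof (cases "t0 = 0")
  case False
  have "\<forall>i. \<exists>q. \<forall>s. F (s *s x0) $ i = poly q s"
    using F polynomial_fun_ray unfolding polynomial_map_def by metis
  then obtain v where v: "\<And>i s. F (s *s x0) $ i = poly (v i) s" by metis
  \<comment> \<open>The curve \<open>W s\<close> is \<open>F (s *s x0)\<close> divided by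
    \<open>t0\<close>, so \<open>W 0 = 0\<close>, \<open>W 1 = w\<close>, and
    \<open>t0 *s W s\<close> is in the range for every \<open>s\<close>.\<close>
  define u where "u = (\<lambda>i. smult (1 / t0) (v i))"
  define W where "W = (\<lambda>s. \<chi> i. poly (u i) s)"
  have W: "t0 *s W s = F (s *s x0)" for s
    using False v by (simp add: W_def u_def vec_eq_iff)
  have W1: "W 1 = w" using W[of 1] t0 False vector_mul_lcancel[of t0 "W 1" w] by simp
  have W0: "W 0 = 0" using W[of 0] F0 False by (simp add: vec_eq_iff)
  have cont_W: "continuous_on S W" for S
    unfolding W_def by (intro continuous_intros)
  \<comment> \<open>The polynomial \<open>[:0, u i:]\<close> encodes \<open>t\<close> times the
    \<open>i\<close>-th coordinate of \<open>W s\<close>.\<close>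
  obtain A where "\<And>s t. a (\<chi> i. poly (spec s [:0, u i:]) t) = poly (spec s A) t"
    using polynomial_fun_bivariate[OF a, of "\<lambda>i. [:0, u i:]"] by blast
  moreover have "(\<chi> i. poly (spec s [:0, u i:]) t) = t *s W s" for s t
    by (simp add: W_def vec_eq_iff)
  ultimately have A: "a (t *s W s) = poly (spec s A) t" for s t by simp
  have "\<forall>k. \<exists>q. \<forall>s. b k (W s) = poly q s"
    unfolding W_def using polynomial_fun_curve[OF b] by blast
  then obtain \<beta> where \<beta>: "\<And>k s. b k (W s) = poly (\<beta> k) s" by metis
  define B where "B = (\<Sum>k\<le>N. monom (\<beta> k) k)"
  have B: "poly (spec s B) t = (\<Sum>k\<le>N. b k (W s) * t ^ k)" for s t
    by (simp add: B_def spec_sum spec_monom poly_sum poly_monom \<beta>)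
  \<comment> \<open>The slice of \<open>A\<close> at \<open>s = 1\<close> is \<open>a\<close> on the
    ray through \<open>w\<close>, which is regular.\<close>
  have "A \<noteq> 0" using w(1) A[of _ 1] W1 unfolding regular_def by auto
  then have "gcd A B \<noteq> 0" by simp
  then obtain D P where DP: "A = D * gcd A B" "B = P * gcd A B" "coprime D P"
    using gcd_coprime_exists by blast
  define \<gamma> where "\<gamma> = gcd A B"
  have AB: "A = D * \<gamma>" "B = P * \<gamma>" using DP unfolding \<gamma>_def by simp_all
  obtain e1 e2 e where e: "e \<noteq> 0" "e1 * D + e2 * P = [:e:]"
    using coprime_imp_bezout_const[OF DP(3)] by blast
  let ?\<Omega> = "{st. snd st *s W (fst st) \<in> range F}"
  have cont_ray: "continuous_on S (\<lambda>st. snd st *s W (fst st))" for S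
    by (intro continuous_on_smult_vec continuous_intros continuous_on_compose2[OF cont_W[of UNIV]]) auto
  have open_\<Omega>: "open ?\<Omega>"
    using cont_ray[of UNIV] open_range by (simp add: continuous_on_open_vimage vimage_def)
  define h where "h = (\<lambda>st. poly (spec (fst st) D) (snd st) * g (snd st *s W (fst st)) - poly (spec (fst st) P) (snd st))"
  have "continuous_on ?\<Omega> (\<lambda>st. g (snd st *s W (fst st)))"
    by (rule continuous_on_compose2[OF cont_g cont_ray]) auto
  then have cont_h: "continuous_on ?\<Omega> h"
    unfolding h_def by (intro continuous_intros continuous_on_spec)
  \<comment> \<open>Where \<open>A\<close> is nonzero, \<open>a_g\<close> applies and the common
    factor \<open>\<gamma>\<close> cancels; such points are dense, and \<open>h\<close> is
    continuous.\<close>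
  have h0: "h st = 0" if "st \<in> ?\<Omega>" for st
  proof (rule ccontr)
    assume "h st \<noteq> 0"
    then have "(fst st, snd st) \<in> ?\<Omega> \<inter> h -` (- {0})" using that by simp
    moreover have "open (?\<Omega> \<inter> h -` (- {0}))"
      by (rule continuous_open_preimage[OF cont_h open_\<Omega>]) auto
    ultimately obtain s t where st: "(s, t) \<in> ?\<Omega> \<inter> h -` (- {0})" "poly (spec s A) t \<noteq> 0"
      using spec_nonzero_dense[OF \<open>A \<noteq> 0\<close>] by blast
    then have "a (t *s W s) * g (t *s W s) = (\<Sum>k\<le>N. b k (W s) * t ^ k)"
      using a_g[of t "W s" t] A by auto
    then have "poly (spec s (D * \<gamma>)) t * g (t *s W s) = poly (spec s (P * \<gamma>)) t"
      using A B AB by simp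
    then have "poly (spec s \<gamma>) t * h (s, t) = 0" by (simp add: h_def algebra_simps)
    moreover have "poly (spec s \<gamma>) t \<noteq> 0" using st(2) AB(1) by auto
    ultimately show False using st(1) by simp
  qed
  have rel: "poly (spec s D) t * g (t *s W s) = poly (spec s P) t" if "t *s W s \<in> range F" for s t
    using h0[of "(s, t)"] that by (simp add: h_def)
  \<comment> \<open>If the slice of \<open>D\<close> at \<open>s\<close> vanished, so would that of
    \<open>P\<close>, and the linear factor with root \<open>s\<close> would divide both
    \<open>D\<close> and \<open>P\<close>.\<close>
  have spec_D: "spec s D \<noteq> 0" for s
  proof
    assume "spec s D = 0"
    moreover from this have "spec s P = 0"
      by (intro poly_eq_0_if_zero_on_open[OF open_ray[of "W s"] ray_nonempty]) (use rel[of _ s] in auto)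
    moreover have "[:[:- s, 1:]:] dvd Q" if "spec s Q = 0" for Q
    proof -
      have "poly (coeff Q k) s = 0" for k using that coeff_spec[of s Q k] by simp
      then show ?thesis by (simp add: const_poly_dvd_iff poly_eq_0_iff_dvd)
    qed
    ultimately have "[:[:- s, 1:]:] dvd (1 :: complex poly poly)"
      using DP(3) by (meson coprime_common_divisor)
    then show False by (auto simp: is_unit_poly_iff)
  qed
  \<comment> \<open>By \<open>rel\<close>, a zero of \<open>D\<close> over the range is also one of
    \<open>P\<close>, which the Bezout relation forbids where \<open>e\<close> is nonzero. The roots
    of \<open>e\<close> are isolated, so Hurwitz's theorem covers them.\<close>
  have D_nz: "poly (spec s0 D) t1 \<noteq> 0" if st: "t1 *s W s0 \<in> range F" for s0 t1
  proof -
    have "finite {s. poly e s = 0}" using e(1) by (rule poly_roots_finite)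
    then obtain \<epsilon>1 where \<epsilon>1: "\<epsilon>1 > 0" "\<And>s. s \<in> {s. poly e s = 0} - {s0} \<Longrightarrow> \<epsilon>1 \<le> dist s0 s"
      using finite_set_avoid[of "{s. poly e s = 0}" s0] by auto
    have "(s0, t1) \<in> ?\<Omega>" using st by simp
    from open_prod_elim[OF open_\<Omega> this] obtain X Y where
      XY: "open X" "open Y" "(s0, t1) \<in> X \<times> Y" "X \<times> Y \<subseteq> ?\<Omega>" .
    then have XY': "s0 \<in> X" "t1 \<in> Y" by simp_all
    obtain \<epsilon>2 where \<epsilon>2: "\<epsilon>2 > 0" "ball s0 \<epsilon>2 \<subseteq> X" using XY(1) XY'(1) by (rule openE)
    obtain \<epsilon>3 where \<epsilon>3: "\<epsilon>3 > 0" "ball t1 \<epsilon>3 \<subseteq> Y" using XY(2) XY'(2) by (rule openE)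
    define \<epsilon> where "\<epsilon> = min \<epsilon>1 (min \<epsilon>2 \<epsilon>3)"
    show ?thesis
    proof (rule spec_nonzero_by_Hurwitz[OF spec_D, of \<epsilon>])
      show "\<epsilon> > 0" using \<epsilon>1 \<epsilon>2 \<epsilon>3 by (simp add: \<epsilon>_def)
      fix s t assume s: "s \<in> ball s0 \<epsilon> - {s0}" and t: "t \<in> ball t1 \<epsilon>"
      have "poly e s \<noteq> 0" using \<epsilon>1(2)[of s] s by (auto simp: \<epsilon>_def)
      moreover have "(s, t) \<in> ?\<Omega>" 
      proof -
        have "s \<in> X" "t \<in> Y" using s t \<epsilon>2(2) \<epsilon>3(2) by (auto simp: \<epsilon>_def)
        then show ?thesis using XY(4) by blast
      qed
      moreover have "poly (spec s e1) t * poly (spec s D) t + poly (spec s e2) t * poly (spec s P) t = poly e s"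
        using arg_cong[OF e(2), of "\<lambda>Q. poly (spec s Q) t"] by simp
      ultimately show "poly (spec s D) t \<noteq> 0" using rel[of t s] by auto
    qed
  qed
  have const_s: "poly (spec s D) t = poly (spec s' D) t" if "\<And>s. t *s W s \<in> range F" for s s' t
    unfolding poly_spec_swap
    by (rule nonvanishing_poly_const) (rule D_nz[OF that, unfolded poly_spec_swap])
  have "poly (spec 1 D) t0 = poly (spec 0 D) t0" by (rule const_s) (simp add: W)
  also have "\<dots> = poly (spec 0 D) 0"
    using nonvanishing_poly_const[of "spec 0 D" t0 0] D_nz[of _ 0] W0 F0
    by (metis rangeI vector_smult_rzero)
  also have "\<dots> = poly (spec 1 D) 0"
    by (rule const_s) (rule zero_in_ray)
  finally have eq: "poly (spec 1 D) t0 = poly (spec 1 D) 0" .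
  have "degree D \<le> degree d"
  proof -
    \<comment> \<open>At an \<open>s\<close> avoiding the roots of these three factors, the slices
      of \<open>D\<close> and \<open>P\<close> are coprime, the direction \<open>W s\<close> is
      regular, and the slice of \<open>D\<close> keeps its full degree. Maximality of
      \<open>degree d\<close> then bounds \<open>degree D\<close>.\<close>
    have "e * lead_coeff A * lead_coeff D \<noteq> 0" using e(1) \<open>A \<noteq> 0\<close> AB(1) by auto
    then obtain s where "poly (e * lead_coeff A * lead_coeff D) s \<noteq> 0"
      by (metis poly_all_0_iff_0)
    then have s: "poly e s \<noteq> 0" "poly (lead_coeff A) s \<noteq> 0" "poly (lead_coeff D) s \<noteq> 0" by auto
    have "spec s A \<noteq> 0" using s(2) coeff_spec[of s A "degree A"] by auto
    then have "regular (W s)"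
      unfolding regular_def A by (metis poly_all_0_iff_0)
    moreover have "denominator (W s) (spec s D)"
    proof -
      have "coprime (spec s D) (spec s P)"
      proof (rule coprimeI)
        fix c assume c: "c dvd spec s D" "c dvd spec s P"
        have "c dvd spec s e1 * spec s D + spec s e2 * spec s P" using c by (intro dvd_add dvd_mult)
        also have "\<dots> = [:poly e s:]" using arg_cong[OF e(2), of "spec s"] by simp
        also have "\<dots> dvd 1" using s(1) by (simp add: is_unit_const_poly_iff dvd_field_iff)
        finally show "is_unit c" .
      qed
      then show ?thesis unfolding denominator_def using spec_D rel by blast
    qed
    ultimately have "degree (spec s D) \<le> degree d" by (rule max)
    moreover have "degree D \<le> degree (spec s D)"
      using s(3) coeff_spec[of s D "degree D"] by (intro le_degree) simp
    ultimately show ?thesis by simp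
  qed
  \<comment> \<open>This slice has degree at most \<open>degree d\<close>, so it is a constant
    multiple of \<open>d\<close>.\<close>
  moreover have "d dvd spec 1 D"
    by (rule denominator_dvd[OF w(2), of _ "spec 1 P"]) (use rel[of _ 1] W1 in simp)
  ultimately obtain c where "spec 1 D = d * c" "degree (d * c) \<le> degree d"
    using degree_spec_le[of 1 D] by (metis dvdE order_trans)
  moreover have "d \<noteq> 0" "c \<noteq> 0" using spec_D[of 1] \<open>spec 1 D = d * c\<close> by auto
  ultimately have "degree c = 0" by (simp add: degree_mult_eq)
  then obtain c0 where "c = [:c0:]" by (meson degree_eq_zeroE)
  then show ?thesis using eq \<open>spec 1 D = d * c\<close> \<open>c \<noteq> 0\<close> by simp
qed simp

text \<open>On a regular ray with denominator of maximal degree, the denominator takes one value on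
  an open set of parameters, so it is constant. The maximal degree is thus 0, and every denominator
  on a regular ray is constant.\<close>

theorem polynomial_on_rays:
  assumes "regular w"
  shows "\<exists>q. degree q \<le> N \<and> (\<forall>t. t *s w \<in> range F \<longrightarrow> g (t *s w) = poly q t)"
proof -
  obtain J where J: "\<And>w. regular w \<Longrightarrow> \<exists>d. denominator w d \<and> degree d \<le> J"
    using denominator_exists by blast
  have dJ: "degree d \<le> J" if reg: "regular w" "denominator w d" for w d
  proof -
    obtain d' where d': "denominator w d'" "degree d' \<le> J" using J[OF reg(1)] by blast
    then have "d dvd d'" using denominator_dvd[OF reg(2)] unfolding denominator_def by blast
    moreover have "d' \<noteq> 0" using d'(1) unfolding denominator_def by blast
    ultimately show ?thesis using dvd_imp_degree_le[of d d'] d'(2) by linarith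
  qed
  obtain d where d: "denominator w d" using J assms by blast
  define R where "R = (\<lambda>m. \<exists>w d. regular w \<and> denominator w d \<and> degree d = m)"
  have "R (degree d)" "\<And>m. R m \<Longrightarrow> m \<le> J" using assms d dJ unfolding R_def by blast+
  then have "R (Greatest R)" "\<And>m. R m \<Longrightarrow> m \<le> Greatest R"
    by (blast intro: GreatestI_nat, blast intro: Greatest_le_nat)
  then obtain w' d' where w': "regular w'" "denominator w' d'" and
    max: "\<And>w'' d''. regular w'' \<Longrightarrow> denominator w'' d'' \<Longrightarrow> degree d'' \<le> degree d'"
    unfolding R_def by metis
  have "d' = [:poly d' 0:]"
    by (rule poly_eq_if_eq_on_open[OF open_ray[of w'] ray_nonempty])
       (use denominator_const_if_max_degree[OF w' max] in auto)
  then have "degree d' = 0" by (metis degree_pCons_0)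
  then have "degree d = 0" using max[OF assms d] by simp
  then obtain c where c: "d = [:c:]" by (meson degree_eq_zeroE)
  then obtain q where c0: "c \<noteq> 0" and q: "\<And>t. t *s w \<in> range F \<Longrightarrow> c * g (t *s w) = poly q t"
    using d unfolding denominator_def by auto
  from polynomial_fun_ray[OF a] obtain \<alpha> where \<alpha>: "\<And>t. a (t *s w) = poly \<alpha> t" by metis
  have "\<alpha> \<noteq> 0" using assms \<alpha> unfolding regular_def by auto
  define p where "p = (\<Sum>k\<le>N. monom (b k w) k)"
  \<comment> \<open>Comparison with the original fraction bounds the degree of \<open>q\<close> by
    that of the numerator \<open>p\<close>.\<close>
  have "\<alpha> * q = smult c p"
  proof (rule poly_eq_if_eq_on_open[OF open_ray[of w] ray_nonempty])
    fix t assume "t \<in> {t. t *s w \<in> range F}"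
    then have t: "t *s w \<in> range F" by simp
    have "poly p t = (\<Sum>k\<le>N. b k w * t ^ k)" by (simp add: p_def poly_sum poly_monom)
    also have "\<dots> = poly \<alpha> t * g (t *s w)"
    proof -
      from assms obtain \<tau> where "a (\<tau> *s w) \<noteq> 0" unfolding regular_def by blast
      from a_g[OF this t] show ?thesis by (simp only: \<alpha>)
    qed
    finally show "poly (\<alpha> * q) t = poly (smult c p) t" using q[OF t, symmetric] by simp
  qed
  moreover have "degree p \<le> N"
    unfolding p_def by (intro degree_sum_le) (auto intro: order_trans[OF degree_monom_le])
  ultimately have "degree (\<alpha> * q) \<le> N" using degree_smult_le[of c p] by simp
  then have "degree q \<le> N" using \<open>\<alpha> \<noteq> 0\<close> by (cases "q = 0") (auto simp: degree_mult_eq)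
  moreover have "g (t *s w) = poly (smult (1 / c) q) t" if "t *s w \<in> range F" for t
    using q[OF that, symmetric] c0 by simp
  ultimately show ?thesis
    by (intro exI[of _ "smult (1 / c) q"]) (auto intro: order_trans[OF degree_smult_le])
qed

end

subsection \<open>The inverse of an injective cubic map\<close>

lemma cubic_map_nth: "cubic_map A x $ i = x $ i + (\<Sum>j\<in>UNIV. A $ i $ j * x $ j) ^ 3"
  by (simp add: cubic_map_def power3_eq_cube matrix_vector_mult_def)

lemma polynomial_map_cubic_map: "polynomial_map (cubic_map A)"
  unfolding polynomial_map_def cubic_map_nth by (intro allI polynomial_fun_intros)

lemma cubic_map_0: "cubic_map A 0 = 0"
  by (simp add: vec_eq_iff cubic_map_nth)

text \<open>Factoring a difference of cubes turns differences of values of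
  \<open>cubic_map A\<close> into this matrix applied to \<open>x - y\<close>, see
  \<open>cubic_map_diff\<close>. For \<open>x = y\<close> it is the Jacobian matrix.\<close>

definition secant_matrix ::
  "complex ^ 'n ^ 'n \<Rightarrow> complex ^ 'n \<Rightarrow> complex ^ 'n \<Rightarrow> complex ^ 'n ^ 'n" where
  "secant_matrix A x y = (\<chi> i k. (if i = k then 1 else 0) +
     (((A *v x) $ i)\<^sup>2 + (A *v x) $ i * (A *v y) $ i + ((A *v y) $ i)\<^sup>2) * A $ i $ k)"

lemma cubic_map_diff: "cubic_map A x - cubic_map A y = secant_matrix A x y *v (x - y)"
proof -
  have "(secant_matrix A x y *v (x - y)) $ i = (cubic_map A x - cubic_map A y) $ i" for i
  proof -
    let ?u = "(A *v x) $ i" and ?v = "(A *v y) $ i"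
    have "(secant_matrix A x y *v (x - y)) $ i
      = (\<Sum>k\<in>UNIV. (if i = k then 1 else 0) * (x - y) $ k) +
        (?u\<^sup>2 + ?u * ?v + ?v\<^sup>2) * (A *v (x - y)) $ i"
      by (simp add: secant_matrix_def matrix_vector_mult_def sum.distrib distrib_right
          sum_distrib_left mult.assoc)
    also have "(\<Sum>k\<in>UNIV. (if i = k then 1 else 0) * (x - y) $ k) = x $ i - y $ i"
      by (simp add: if_distrib[of "\<lambda>a. a * _"] cong: if_cong)
    also have "A *v (x - y) = A *v x - A *v y" by (rule matrix_vector_mult_diff_distrib)
    also have "x $ i - y $ i + (?u\<^sup>2 + ?u * ?v + ?v\<^sup>2) * (A *v x - A *v y) $ i
      = (x $ i + ?u ^ 3) - (y $ i + ?v ^ 3)"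
      by (simp add: algebra_simps power2_eq_square power3_eq_cube)
    finally show ?thesis
      by (simp add: cubic_map_def power3_eq_cube)
  qed
  then show ?thesis by (simp add: vec_eq_iff)
qed

lemma continuous_on_det:
  fixes M :: "'a :: topological_space \<Rightarrow> complex ^ 'n ^ 'n"
  assumes "\<And>i k. continuous_on S (\<lambda>t. M t $ i $ k)"
  shows "continuous_on S (\<lambda>t. det (M t))"
  unfolding det_def by (intro continuous_intros assms)

lemma polynomial_fun_det_secant_matrix: "polynomial_fun (\<lambda>x. det (secant_matrix A x x))"
  unfolding det_def secant_matrix_def matrix_vector_mult_def
  by (simp, intro polynomial_fun_intros)

lemma det_secant_matrix_0: "det (secant_matrix A 0 0) = 1"
proof -
  have "secant_matrix A 0 0 = mat 1" by (simp add: secant_matrix_def mat_def vec_eq_iff)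
  then show ?thesis by (simp add: det_I)
qed

text \<open>The equation F(X(t)) = t w with X(0) = 0 in formal power series; the Taylor expansion of
  the inverse along the ray will solve it.\<close>

definition cubic_series :: "complex ^ 'n ^ 'n \<Rightarrow> complex ^ 'n \<Rightarrow> ('n \<Rightarrow> complex fps) \<Rightarrow> bool" where
  "cubic_series A w X \<longleftrightarrow> (\<forall>i. fps_nth (X i) 0 = 0) \<and>
     (\<forall>i. X i + (\<Sum>j\<in>UNIV. fps_const (A $ i $ j) * X j) ^ 3 = fps_const (w $ i) * fps_X)"

text \<open>The linear form inside the cube has no constant term, so the equation expresses the
  coefficient of order \<open>n\<close> polynomially through \<open>w\<close> and coefficients of
  lower order.\<close>

lemma cubic_series_coeff:
  fixes A :: "complex ^ 'n ^ 'n"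
  shows "\<exists>p. polynomial_fun p \<and> (\<forall>w X. cubic_series A w X \<longrightarrow> fps_nth (X i) n = p w)"
proof (induction n arbitrary: i rule: less_induct)
  case (less n)
  show ?case
  proof (cases "n = 0")
    case True
    then show ?thesis
      by (intro exI[of _ "\<lambda>_. 0"]) (auto simp: cubic_series_def polynomial_fun_const)
  next
    case False
    from less have "\<forall>m j. m < n \<longrightarrow> (\<exists>p. polynomial_fun p \<and>
        (\<forall>w X. cubic_series A w X \<longrightarrow> fps_nth (X j) m = p w))" by blast
    then obtain e where e: "\<And>m j. m < n \<Longrightarrow> polynomial_fun (e m j)"
      "\<And>m j w X. m < n \<Longrightarrow> cubic_series A w X \<Longrightarrow> fps_nth (X j) m = e m j w"
      by metis
    \<comment> \<open>In the \<open>n\<close>-th coefficient of the cube, coefficients of order \<open>n\<close> only meet constant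
      terms, which vanish, so they can be replaced by \<open>0\<close>.\<close>
    define q where "q = (\<lambda>m w. if m < n then (\<Sum>j\<in>UNIV. A $ i $ j * e m j w) else 0)"
    have q: "polynomial_fun (q m)" for m
      unfolding q_def by (cases "m < n") (auto intro!: polynomial_fun_intros e(1))
    define p where "p = (\<lambda>w. w $ i * (if n = 1 then 1 else 0)
      - (\<Sum>k=0..n. (\<Sum>l=0..k. q l w * q (k - l) w) * q (n - k) w))"
    have "polynomial_fun p"
      unfolding p_def by (intro polynomial_fun_intros q)
    moreover have "fps_nth (X i) n = p w" if X: "cubic_series A w X" for w X
    proof -
      define Y where "Y = (\<Sum>j\<in>UNIV. fps_const (A $ i $ j) * X j)"
      have Y_nth: "fps_nth Y m = (\<Sum>j\<in>UNIV. A $ i $ j * fps_nth (X j) m)" for m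
        by (simp add: Y_def fps_sum_nth)
      have Y0: "fps_nth Y 0 = 0" unfolding Y_nth using X by (simp add: cubic_series_def)
      have Yq: "fps_nth Y m = q m w" if "m < n" for m
        unfolding Y_nth q_def using that e(2)[OF that X] by simp
      have q0: "q 0 w = 0" using Yq[of 0] Y0 False by simp
      have Y3: "Y ^ 3 = Y * Y * Y" by (simp add: power3_eq_cube)
      have "fps_nth (Y ^ 3) n = (\<Sum>k=0..n. (\<Sum>l=0..k. fps_nth Y l * fps_nth Y (k - l)) * fps_nth Y (n - k))"
        unfolding Y3 by (simp only: fps_mult_nth)
      also have "\<dots> = (\<Sum>k=0..n. (\<Sum>l=0..k. q l w * q (k - l) w) * q (n - k) w)"
      proof (rule sum.cong[OF refl])
        fix k assume k: "k \<in> {0..n}"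
        consider "k = 0" | "k = n" | "0 < k" "k < n" using k by fastforce
        then show "(\<Sum>l=0..k. fps_nth Y l * fps_nth Y (k - l)) * fps_nth Y (n - k)
          = (\<Sum>l=0..k. q l w * q (k - l) w) * q (n - k) w"
        proof cases
          case 3
          then have "(\<Sum>l=0..k. fps_nth Y l * fps_nth Y (k - l)) = (\<Sum>l=0..k. q l w * q (k - l) w)"
            by (intro sum.cong refl arg_cong2[of _ _ _ _ "(*)"] Yq) auto
          then show ?thesis using Yq[of "n - k"] 3 by simp
        qed (simp_all add: Y0 q0)
      qed
      finally have "fps_nth (Y ^ 3) n = (\<Sum>k=0..n. (\<Sum>l=0..k. q l w * q (k - l) w) * q (n - k) w)" .
      moreover have "fps_nth (X i) n + fps_nth (Y ^ 3) n = w $ i * (if n = 1 then 1 else 0)"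
      proof -
        have "X i + Y ^ 3 = fps_const (w $ i) * fps_X" using X unfolding cubic_series_def Y_def by blast
        then have "fps_nth (X i + Y ^ 3) n = fps_nth (fps_const (w $ i) * fps_X) n" by (simp only:)
        then show ?thesis by (simp add: fps_X_def)
      qed
      ultimately show ?thesis by (simp add: p_def eq_diff_eq)
    qed
    ultimately show ?thesis by blast
  qed
qed

lemma norm_smult_vec: "norm (c *s x) = norm c * norm (x :: complex ^ 'n)"
  by (simp add: norm_vec_def norm_mult L2_set_right_distrib)

lemma norm_le_of_coords:
  fixes x :: "complex ^ 'n"
  assumes "\<And>i. norm (x $ i) \<le> K"
  shows "norm x \<le> real CARD('n) * K"
proof -
  have "norm x \<le> (\<Sum>i\<in>UNIV. norm (x $ i))"
    unfolding norm_vec_def by (rule L2_set_le_sum) simp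
  also have "\<dots> \<le> (\<Sum>i\<in>(UNIV :: 'n set). K)" by (intro sum_mono assms)
  finally show ?thesis by simp
qed

lemma poly_has_fps_expansion: "poly p has_fps_expansion fps_of_poly (p :: complex poly)"
  by (simp add: has_fps_expansion_def)

section \<open>Range and differentiability of the inverse\<close>

locale injective_cubic_map =
  fixes A :: "complex ^ 'n ^ 'n"
  assumes inj: "inj (cubic_map A)"
begin

abbreviation "F \<equiv> cubic_map A"
abbreviation "G \<equiv> inv F"
abbreviation "ray w \<equiv> {t. t *s w \<in> range F}"

lemma open_range: "open (range F)"
  by (rule invariance_of_domain) (simp_all add: inj continuous_on_polynomial_map polynomial_map_cubic_map)

lemma continuous_on_G: "continuous_on (range F) G"
  by (rule continuous_on_inverse_open)
     (simp_all add: inj continuous_on_polynomial_map polynomial_map_cubic_map)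

lemma F_G: "w \<in> range F \<Longrightarrow> F (G w) = w"
  by (rule f_inv_into_f)

lemma G_0: "G 0 = 0"
  using inv_f_f[OF inj, of 0] by (simp add: cubic_map_0)

lemma continuous_on_smult: "continuous_on S (\<lambda>t. t *s w)" for w :: "complex ^ 'n"
  by (intro continuous_on_smult_vec continuous_intros)

lemma open_ray: "open (ray w)"
  using continuous_on_smult[of UNIV] open_range by (simp add: continuous_on_open_vimage vimage_def)

lemma zero_in_ray: "0 \<in> ray w"
  using cubic_map_0[of A] by (metis mem_Collect_eq rangeI vector_smult_lzero)

lemma continuous_on_G_ray: "continuous_on (ray w) (\<lambda>t. G (t *s w))"
  by (rule continuous_on_compose2[OF continuous_on_G continuous_on_smult]) auto

text \<open>The difference quotient of the inverse along the ray solves a linear system with the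
  secant matrix and right-hand side \<open>w\<close>. Cramer's rule writes it as a quotient of
  determinants that are continuous in \<open>t\<close>.\<close>

lemma G_ray_differentiable:
  assumes t0: "t0 \<in> ray w"
    and det: "det (secant_matrix A (G (t0 *s w)) (G (t0 *s w))) \<noteq> 0"
  shows "(\<lambda>t. G (t *s w) $ k) field_differentiable (at t0)"
proof -
  define x where "x = (\<lambda>t. G (t *s w))"
  define M where "M = (\<lambda>t. secant_matrix A (x t) (x t0))"
  define D where "D = (\<lambda>t. det (\<chi> i j. if j = k then w $ i else M t $ i $ j))"
  have x: "continuous_on (ray w) x" unfolding x_def by (rule continuous_on_G_ray)
  have M: "continuous_on (ray w) (\<lambda>t. M t $ i $ j)" for i j
    unfolding M_def secant_matrix_def matrix_vector_mult_def vec_lambda_beta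
    by (intro continuous_intros x)
  have "continuous_on (ray w) (\<lambda>t. (\<chi> i j. if j = k then w $ i else M t $ i $ j) $ i $ j)" for i j
    by (cases "j = k") (auto intro: M)
  then have "continuous_on (ray w) D" unfolding D_def by (rule continuous_on_det)
  then have D: "isCont D t0" using t0 open_ray continuous_on_eq_continuous_at by blast
  have "continuous_on (ray w) (\<lambda>t. det (M t))" using M by (rule continuous_on_det)
  then have dM: "isCont (\<lambda>t. det (M t)) t0" using t0 open_ray continuous_on_eq_continuous_at by blast
  have dM0: "det (M t0) \<noteq> 0" using det by (simp add: M_def x_def)
  have "((\<lambda>t. D t / det (M t)) \<longlongrightarrow> D t0 / det (M t0)) (at t0)"
    using D dM dM0 by (intro tendsto_divide) (auto simp: isCont_def)
  moreover have "eventually (\<lambda>t. D t / det (M t) = (x t $ k - x t0 $ k) / (t - t0)) (at t0)"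
  proof -
    have "eventually (\<lambda>t. det (M t) \<noteq> 0) (at t0)"
      using dM dM0 by (intro tendsto_imp_eventually_ne) (auto simp: isCont_def)
    moreover have "eventually (\<lambda>t. t \<in> ray w) (at t0)"
      using open_ray t0 by (rule eventually_at_in_open')
    moreover have "eventually (\<lambda>t. t \<noteq> t0) (at t0)" by (simp add: eventually_at_filter)
    ultimately show ?thesis
    proof eventually_elim
      case (elim t)
      have "M t *v (x t - x t0) = t *s w - t0 *s w"
        using cubic_map_diff[of A "x t" "x t0"] elim t0 by (simp add: M_def x_def F_G)
      also have "\<dots> = (t - t0) *s w" by (simp add: vec_eq_iff algebra_simps)
      finally have "M t *v ((1 / (t - t0)) *s (x t - x t0)) = (1 / (t - t0)) *s ((t - t0) *s w)"
        by (simp only: vector_scalar_commute)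
      moreover have "1 / (t - t0) * (t - t0) = 1" using elim by simp
      ultimately have "M t *v ((1 / (t - t0)) *s (x t - x t0)) = w"
        by (simp only: vector_smult_assoc vector_smult_lid)
      then have "(1 / (t - t0)) *s (x t - x t0)
          = (\<chi> k. det (\<chi> i j. if j = k then w $ i else M t $ i $ j) / det (M t))"
        using cramer[OF elim(1)] by blast
      then have "((1 / (t - t0)) *s (x t - x t0)) $ k = D t / det (M t)" by (simp add: D_def)
      then show ?case by (simp add: diff_divide_distrib)
    qed
  qed
  ultimately have "((\<lambda>t. (x t $ k - x t0 $ k) / (t - t0)) \<longlongrightarrow> D t0 / det (M t0)) (at t0)"
    by (rule Lim_transform_eventually)
  then show ?thesis unfolding field_differentiable_def has_field_derivative_iff x_def by blast
qed

text \<open>\<open>B\<close> is the product of the multipliers obtained for the single coordinates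
  and for the Jacobian determinant. The bound for a coordinate survives because the cofactor
  \<open>g i\<close> grows polynomially.\<close>

lemma common_denominator_exists:
  "\<exists>B C N. polynomial_fun B \<and> (\<exists>w. B w \<noteq> 0) \<and> C \<ge> 0 \<and>
     (\<forall>x i. norm (B (F x) * x $ i) \<le> C * (1 + norm (F x)) ^ N) \<and>
     (\<forall>x. B (F x) \<noteq> 0 \<longrightarrow> det (secant_matrix A x x) \<noteq> 0)"
proof -
  have "\<forall>i :: 'n. \<exists>c C N. polynomial_fun c \<and> (\<exists>w. c w \<noteq> 0) \<and> C \<ge> 0 \<and>
           (\<forall>x. norm (c (F x) * x $ i) \<le> C * (1 + norm (F x)) ^ N)"
    by (intro allI integral_multiple_growth polynomial_fun_coord polynomial_map_cubic_map open_range)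
  then obtain c C N where c: "\<And>i. polynomial_fun (c i)" "\<And>i. \<exists>w. c i w \<noteq> 0" "\<And>i. C i \<ge> 0"
      "\<And>i x. norm (c i (F x) * x $ i) \<le> C i * (1 + norm (F x)) ^ N i"
    by metis
  have "\<exists>x. det (secant_matrix A x x) \<noteq> 0"
    using det_secant_matrix_0[of A] by (intro exI[of _ 0]) simp
  then obtain d where d: "polynomial_fun d" "\<exists>w. d w \<noteq> 0"
    "\<And>x. d (F x) \<noteq> 0 \<Longrightarrow> det (secant_matrix A x x) \<noteq> 0"
    using nonvanishing_off_hypersurface[OF polynomial_fun_det_secant_matrix _ polynomial_map_cubic_map]
    by blast
  define B where "B = (\<lambda>w. d w * (\<Prod>i\<in>UNIV. c i w))"
  define g where "g = (\<lambda>i w. d w * (\<Prod>k\<in>UNIV - {i}. c k w))"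
  have g: "polynomial_fun (g i)" for i
    unfolding g_def by (intro polynomial_fun_intros d c)
  have B_g: "B w = g i w * c i w" for i w
    by (simp add: B_def g_def prod.remove[of UNIV i])
  define h where "h = (\<lambda>i w. norm (g i w) * (C i * (1 + norm w) ^ N i))"
  have "\<exists>K n. K \<ge> 0 \<and> (\<forall>w. (\<Sum>i\<in>UNIV. h i w) \<le> K * (1 + norm w) ^ n)"
  proof (rule polynomial_growth_sum)
    fix i
    obtain K n where K: "K \<ge> 0" "\<And>w. norm (g i w) \<le> K * (1 + norm w) ^ n"
      using polynomial_fun_growth[OF g] by blast
    have "h i w \<le> (K * C i) * (1 + norm w) ^ (n + N i)" for w
    proof -
      have "h i w \<le> (K * (1 + norm w) ^ n) * (C i * (1 + norm w) ^ N i)"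
        unfolding h_def by (intro mult_right_mono K) (use c(3) in auto)
      then show ?thesis by (simp add: power_add mult_ac)
    qed
    then show "\<exists>K n. K \<ge> 0 \<and> (\<forall>w. h i w \<le> K * (1 + norm w) ^ n)"
      using K(1) c(3)[of i] by (intro exI[of _ "K * C i"] exI[of _ "n + N i"]) auto
  qed simp
  then obtain K n where K: "K \<ge> 0" "\<And>w. (\<Sum>i\<in>UNIV. h i w) \<le> K * (1 + norm w) ^ n" by blast
  have "norm (B (F x) * x $ i) \<le> K * (1 + norm (F x)) ^ n" for x i
  proof -
    have "norm (B (F x) * x $ i) = norm (g i (F x)) * norm (c i (F x) * x $ i)"
      by (simp add: B_g[of _ i] norm_mult)
    also have "\<dots> \<le> h i (F x)" unfolding h_def by (intro mult_left_mono c) simp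
    also have "\<dots> \<le> (\<Sum>i\<in>UNIV. h i (F x))"
      by (rule member_le_sum) (auto simp: h_def c(3))
    also have "\<dots> \<le> K * (1 + norm (F x)) ^ n" by (rule K)
    finally show ?thesis .
  qed
  moreover have "polynomial_fun B" unfolding B_def by (intro polynomial_fun_intros d c)
  moreover have "\<exists>w. B w \<noteq> 0"
    unfolding B_def
    by (intro polynomial_fun_mult_nonzero polynomial_fun_prod_nonzero polynomial_fun_prod d c) simp
  moreover have "\<forall>x. B (F x) \<noteq> 0 \<longrightarrow> det (secant_matrix A x x) \<noteq> 0"
    using d(3) by (simp add: B_def)
  ultimately show ?thesis using K(1) by blast
qed

end

section \<open>Extension along rays and assembly of the inverse\<close>

lemma poly_eq_sum_atMost:
  fixes p :: "'a :: comm_ring_1 poly"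
  assumes "degree p \<le> n"
  shows "poly p t = (\<Sum>k\<le>n. coeff p k * t ^ k)"
  unfolding poly_altdef
  by (rule sum.mono_neutral_left) (use assms in \<open>auto simp: coeff_eq_0\<close>)

lemma has_fps_expansion_eventually_eq:
  assumes "f has_fps_expansion F" "eventually (\<lambda>t. f t = g t) (nhds 0)"
  shows "g has_fps_expansion F"
  using assms(1) has_fps_expansion_cong[OF assms(2) refl] by blast

locale cubic_denominator = injective_cubic_map A for A :: "complex ^ 'n ^ 'n" +
  fixes B :: "complex ^ 'n \<Rightarrow> complex" and C :: real and N :: nat
  assumes B: "polynomial_fun B" and B_nz: "\<exists>w. B w \<noteq> 0" and C: "C \<ge> 0"
    and growth: "\<And>x i. norm (B (F x) * x $ i) \<le> C * (1 + norm (F x)) ^ N"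
    and det_nz: "\<And>x. B (F x) \<noteq> 0 \<Longrightarrow> det (secant_matrix A x x) \<noteq> 0"
begin

lemma finite_B_zeros:
  assumes "B (\<tau> *s w) \<noteq> 0"
  shows "finite {t. B (t *s w) = 0}"
proof -
  obtain \<beta> where \<beta>: "\<And>t. B (t *s w) = poly \<beta> t" using polynomial_fun_ray[OF B] by metis
  then have "\<beta> \<noteq> 0" using assms by auto
  then show ?thesis unfolding \<beta> by (rule poly_roots_finite)
qed

lemma continuous_on_B_ray: "continuous_on S (\<lambda>t. B (t *s w))"
  by (rule continuous_on_compose2[OF continuous_on_polynomial_fun[OF B, of UNIV] continuous_on_smult]) auto

text \<open>Off the zeros of \<open>B\<close> the preimages of \<open>t *s w\<close> stay locally bounded, so the ray
  meets the range in a relatively closed set there; the complement of finitely many points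
  in the plane is connected.\<close>

lemma in_ray_if_B_nonzero:
  assumes w: "B (\<tau> *s w) \<noteq> 0" and t: "B (t *s w) \<noteq> 0"
  shows "t \<in> ray w"
proof (rule ccontr)
  assume nt: "t \<notin> ray w"
  define Z where "Z = {t. B (t *s w) = 0}"
  have Z: "finite Z" unfolding Z_def using w by (rule finite_B_zeros)
  have "connected (UNIV - Z)" by (rule connected_open_delete_finite) (use Z in auto)
  moreover have "open (ray w - Z)" using open_ray Z finite_imp_closed by (intro open_Diff)
  moreover have "open (UNIV - Z - ray w)"
  proof (subst open_subopen, intro ballI)
    fix s assume s: "s \<in> UNIV - Z - ray w"
    \<comment> \<open>Outside \<open>Z\<close>, \<open>\<rho> t\<close> bounds each coordinate of
      any preimage of \<open>t *s w\<close>.\<close>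
    define \<rho> where "\<rho> = (\<lambda>t. C * (1 + norm (t *s w)) ^ N / norm (B (t *s w)))"
    have open_Z: "open (UNIV - Z)" using Z finite_imp_closed by (intro open_Diff) auto
    have "continuous_on (UNIV - Z) \<rho>"
      unfolding \<rho>_def norm_smult_vec
      by (intro continuous_intros continuous_on_B_ray) (auto simp: Z_def)
    then have o1: "open ((UNIV - Z) \<inter> \<rho> -` {..<\<rho> s + 1})"
      using open_Z by (rule continuous_open_preimage) simp
    define K where "K = real CARD('n) * (\<rho> s + 1)"
    have "compact (F ` cball 0 K)"
      by (intro compact_continuous_image continuous_on_polynomial_map polynomial_map_cubic_map) simp
    then have "closed (F ` cball 0 K)" by (rule compact_imp_closed)
    then have o2: "open ((\<lambda>t. t *s w) -` (- (F ` cball 0 K)))"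
      using continuous_on_smult[of UNIV w] by (simp add: continuous_on_open_vimage open_Compl)
    \<comment> \<open>For a parameter in \<open>V\<close> any preimage would have norm at most
      \<open>K\<close>, but the point on the ray avoids the image of that ball.\<close>
    define V where "V = ((UNIV - Z) \<inter> \<rho> -` {..<\<rho> s + 1}) \<inter> ((\<lambda>t. t *s w) -` (- (F ` cball 0 K)))"
    have "open V" unfolding V_def using o1 o2 by (rule open_Int)
    moreover have "s \<in> V" using s by (auto simp: V_def)
    moreover have "V \<subseteq> UNIV - Z - ray w"
    proof
      fix u assume u: "u \<in> V"
      have "u \<notin> ray w"
      proof
        assume "u \<in> ray w"
        then obtain x where x: "u *s w = F x" by auto
        have "norm (x $ i) \<le> \<rho> s + 1" for i
        proof -
          have "norm (B (u *s w)) > 0" using u by (auto simp: V_def Z_def)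
          moreover have "norm (B (u *s w)) * norm (x $ i) \<le> C * (1 + norm (u *s w)) ^ N"
            using growth[of x i] by (simp add: norm_mult x)
          ultimately have "norm (x $ i) \<le> \<rho> u" by (simp add: \<rho>_def field_simps)
          then show ?thesis using u by (simp add: V_def)
        qed
        then have "norm x \<le> K" unfolding K_def by (rule norm_le_of_coords)
        then show False using u x by (auto simp: V_def)
      qed
      then show "u \<in> UNIV - Z - ray w" using u by (simp add: V_def)
    qed
    ultimately show "\<exists>V. open V \<and> s \<in> V \<and> V \<subseteq> UNIV - Z - ray w" by blast
  qed
  moreover have "ray w - Z \<noteq> {}"
  proof
    assume "ray w - Z = {}"
    then have "ray w \<subseteq> Z" by (simp only: Diff_eq_empty_iff)
    then have "finite (ray w)" using Z by (rule finite_subset)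
    moreover have "ray w \<noteq> {}" using zero_in_ray[of w] by (rule ex_in_conv[THEN iffD1, OF exI])
    ultimately show False using finite_imp_not_open[of "ray w"] open_ray[of w] by (simp only: not_True_eq_False)
  qed
  moreover have "t \<in> UNIV - Z - ray w" using t nt by (simp add: Z_def)
  ultimately show False
    using connectedD[of "UNIV - Z" "ray w - Z" "UNIV - Z - ray w"] by fast
qed

lemma G_ray_holomorphic_off_zeros:
  assumes "B (\<tau> *s w) \<noteq> 0"
  shows "(\<lambda>t. G (t *s w) $ i) holomorphic_on {t. B (t *s w) \<noteq> 0}"
  unfolding holomorphic_on_def
proof
  fix t assume "t \<in> {t. B (t *s w) \<noteq> 0}"
  then have t: "B (t *s w) \<noteq> 0" by simp
  then have "t \<in> ray w" using assms by (rule in_ray_if_B_nonzero[rotated])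
  moreover have "det (secant_matrix A (G (t *s w)) (G (t *s w))) \<noteq> 0"
    using t \<open>t \<in> ray w\<close> by (intro det_nz) (simp add: F_G)
  ultimately show "(\<lambda>t. G (t *s w) $ i) field_differentiable at t within {t. B (t *s w) \<noteq> 0}"
    by (rule field_differentiable_at_within[OF G_ray_differentiable])
qed

text \<open>The zeros of \<open>B\<close> on the ray are finitely many and the inverse is continuous
  across those in \<open>ray w\<close>, so they are removable singularities.\<close>

lemma G_ray_holomorphic:
  assumes "B (\<tau> *s w) \<noteq> 0"
  shows "(\<lambda>t. G (t *s w) $ i) holomorphic_on ray w"
proof (rule no_isolated_singularity'[where K = "{t. B (t *s w) = 0} \<inter> ray w"])
  have "continuous_on (ray w) (\<lambda>t. G (t *s w) $ i)"
    by (intro continuous_intros continuous_on_G_ray)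
  then show "((\<lambda>t. G (t *s w) $ i) \<longlongrightarrow> G (z *s w) $ i) (at z within ray w)"
    if "z \<in> {t. B (t *s w) = 0} \<inter> ray w" for z
    using that by (simp add: continuous_on_def)
  show "(\<lambda>t. G (t *s w) $ i) holomorphic_on (ray w - {t. B (t *s w) = 0} \<inter> ray w)"
    using G_ray_holomorphic_off_zeros[OF assms] by (rule holomorphic_on_subset) auto
qed (use assms in \<open>simp_all add: open_ray finite_B_zeros\<close>)

text \<open>One factor \<open>B\<close> makes the functions locally bounded; the second one makes them
  continuous at the zeros of \<open>B\<close>.\<close>

lemma B_square_G_polynomial_on_rays:
  "\<exists>n. \<forall>w i. (\<exists>\<tau>. B (\<tau> *s w) \<noteq> 0) \<longrightarrow>
     (\<exists>p. degree p \<le> n \<and> (\<forall>t \<in> ray w. (B (t *s w))\<^sup>2 * G (t *s w) $ i = poly p t))"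
proof -
  obtain D M where D: "D \<ge> 0" "\<And>x. norm (B x) \<le> D * (1 + norm x) ^ M"
    using polynomial_fun_growth[OF B] by blast
  have "\<exists>p. degree p \<le> M + N \<and> (\<forall>t \<in> ray w. (B (t *s w))\<^sup>2 * G (t *s w) $ i = poly p t)"
    if w: "B (\<tau> *s w) \<noteq> 0" for w \<tau> i
  proof -
    define Z where "Z = {t. B (t *s w) = 0}"
    \<comment> \<open>The default value 0 fits: outside \<open>ray w\<close> the factor
      \<open>B\<close> vanishes, by \<open>in_ray_if_B_nonzero\<close>.\<close>
    define h where "h = (\<lambda>t. if t \<in> ray w then (B (t *s w))\<^sup>2 * G (t *s w) $ i else 0)"
    have bound: "norm (h t) \<le> norm (B (t *s w)) * (C * (1 + norm (t *s w)) ^ N)" for t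
    proof (cases "t \<in> ray w")
      case True
      then have "norm (B (t *s w) * G (t *s w) $ i) \<le> C * (1 + norm (t *s w)) ^ N"
        using growth[of "G (t *s w)" i] by (simp add: F_G)
      then have "norm (B (t *s w)) * norm (B (t *s w) * G (t *s w) $ i)
          \<le> norm (B (t *s w)) * (C * (1 + norm (t *s w)) ^ N)"
        by (rule mult_left_mono) simp
      then show ?thesis using True by (simp add: h_def norm_mult power2_eq_square mult.assoc)
    qed (simp add: h_def C)
    have "h holomorphic_on UNIV"
    proof (rule no_isolated_singularity'[where K = Z])
      fix z assume "z \<in> Z"
      then have z: "B (z *s w) = 0" by (simp add: Z_def)
      have "continuous_on UNIV (\<lambda>t. norm (B (t *s w)) * (C * (1 + norm (t *s w)) ^ N))"
        unfolding norm_smult_vec by (intro continuous_intros continuous_on_B_ray)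
      then have "isCont (\<lambda>t. norm (B (t *s w)) * (C * (1 + norm (t *s w)) ^ N)) z"
        by (simp add: continuous_on_eq_continuous_at)
      then have "((\<lambda>t. norm (B (t *s w)) * (C * (1 + norm (t *s w)) ^ N)) \<longlongrightarrow> 0) (at z)"
        using z by (simp add: isCont_def)
      then have "(h \<longlongrightarrow> 0) (at z)"
        by (rule Lim_null_comparison[rotated]) (simp add: bound)
      moreover have "h z = 0" using z by (simp add: h_def)
      ultimately show "(h \<longlongrightarrow> h z) (at z)" by simp
    next
      have eq: "(B (t *s w))\<^sup>2 * G (t *s w) $ i = h t" if "t \<in> UNIV - Z" for t
        using in_ray_if_B_nonzero[OF w, of t] that by (simp add: h_def Z_def)
      obtain \<beta> where \<beta>: "\<And>t. B (t *s w) = poly \<beta> t" using polynomial_fun_ray[OF B] by metis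
      have "(\<lambda>t. (poly \<beta> t)\<^sup>2 * G (t *s w) $ i) holomorphic_on (UNIV - Z)"
        using G_ray_holomorphic_off_zeros[OF w, of i]
        by (intro holomorphic_intros) (auto elim: holomorphic_on_subset simp: Z_def)
      then show "h holomorphic_on (UNIV - Z)"
        by (rule holomorphic_transform) (use eq \<beta> in auto)
    qed (use finite_B_zeros[OF w] in \<open>auto simp: Z_def\<close>)
    moreover have "norm (h t) \<le> D * C * (1 + norm w) ^ (M + N) * norm t ^ (M + N)" if "1 \<le> norm t" for t
    proof -
      have "norm (h t) \<le> (D * (1 + norm (t *s w)) ^ M) * (C * (1 + norm (t *s w)) ^ N)"
        by (rule order_trans[OF bound]) (intro mult_right_mono D, use C in auto)
      also have "\<dots> = D * C * (1 + norm (t *s w)) ^ (M + N)" by (simp add: power_add mult_ac)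
      also have "\<dots> \<le> D * C * ((1 + norm w) * norm t) ^ (M + N)"
      proof (intro mult_left_mono power_mono)
        show "1 + norm (t *s w) \<le> (1 + norm w) * norm t"
          using that by (simp add: norm_smult_vec algebra_simps)
      qed (use C D in auto)
      finally show ?thesis by (simp add: power_mult_distrib mult_ac)
    qed
    \<comment> \<open>Liouville's theorem for polynomial growth; the exponent \<open>M + N\<close>
      depends on neither \<open>w\<close> nor \<open>i\<close>.\<close>
    ultimately have h: "h t = (\<Sum>k\<le>M + N. (deriv ^^ k) h 0 / fact k * t ^ k)" for t
      by (rule Liouville_polynomial)
    define p where "p = (\<Sum>k\<le>M + N. monom ((deriv ^^ k) h 0 / fact k) k)"
    have "degree p \<le> M + N"
      unfolding p_def by (intro degree_sum_le) (auto intro: order_trans[OF degree_monom_le])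
    moreover have "(B (t *s w))\<^sup>2 * G (t *s w) $ i = poly p t" if "t \<in> ray w" for t
      using h[of t] that by (simp add: h_def p_def poly_sum poly_monom)
    ultimately show ?thesis by blast
  qed
  then show ?thesis by blast
qed

text \<open>Near 0 the identity F(G(t w)) = t w holds between holomorphic functions, and power
  series expansions are unique.\<close>

lemma G_ray_cubic_series:
  assumes "B (\<tau> *s w) \<noteq> 0"
  shows "\<exists>X. cubic_series A w X \<and> (\<forall>i. (\<lambda>t. G (t *s w) $ i) has_fps_expansion X i)"
proof -
  define X where "X = (\<lambda>i. fps_expansion (\<lambda>t. G (t *s w) $ i) 0)"
  have X: "(\<lambda>t. G (t *s w) $ i) has_fps_expansion X i" for i
    unfolding X_def
  proof (rule analytic_at_imp_has_fps_expansion_0)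
    show "(\<lambda>t. G (t *s w) $ i) analytic_on {0}"
      using G_ray_holomorphic[OF assms, of i] open_ray[of w] zero_in_ray[of w]
      unfolding analytic_at by blast
  qed
  have "fps_nth (X i) 0 = 0" for i
    using X[of i] by (simp add: has_fps_expansion_to_laurent G_0)
  moreover have "X i + (\<Sum>j\<in>UNIV. fps_const (A $ i $ j) * X j) ^ 3 = fps_const (w $ i) * fps_X" for i
  proof (rule fps_expansion_unique_complex)
    show "(\<lambda>t. w $ i * t) has_fps_expansion fps_const (w $ i) * fps_X"
      by (intro fps_expansion_intros)
    have "(\<lambda>t. G (t *s w) $ i + (\<Sum>j\<in>UNIV. A $ i $ j * G (t *s w) $ j) ^ 3) has_fps_expansion
        X i + (\<Sum>j\<in>UNIV. fps_const (A $ i $ j) * X j) ^ 3"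
      by (intro fps_expansion_intros X)
    moreover have "eventually (\<lambda>t. t \<in> ray w) (nhds 0)"
      using open_ray zero_in_ray by (rule eventually_nhds_in_open)
    then have "eventually (\<lambda>t. G (t *s w) $ i + (\<Sum>j\<in>UNIV. A $ i $ j * G (t *s w) $ j) ^ 3 = w $ i * t) (nhds 0)"
    proof eventually_elim
      case (elim t)
      then have "F (G (t *s w)) $ i = (t *s w) $ i" by (simp add: F_G)
      then show ?case by (simp add: cubic_map_nth mult.commute)
    qed
    ultimately show "(\<lambda>t. w $ i * t) has_fps_expansion
        X i + (\<Sum>j\<in>UNIV. fps_const (A $ i $ j) * X j) ^ 3"
      by (rule has_fps_expansion_eventually_eq)
  qed
  ultimately show ?thesis using X unfolding cubic_series_def by blast
qed

text \<open>On generic rays the inverse is a polynomial in \<open>t\<close> of degree at most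
  \<open>n\<close> with Taylor coefficients \<open>E k i w\<close>. At \<open>t = 1\<close> this
  writes \<open>G w\<close> as a polynomial in \<open>w\<close>, first on an open set only; the
  identity theorem extends the equation \<open>F (Q w) = w\<close> to all \<open>w\<close>.\<close>

theorem polynomial_right_inverse: "\<exists>Q. polynomial_map Q \<and> (\<forall>w. F (Q w) = w)"
proof -
  have "\<forall>n i. \<exists>p. polynomial_fun p \<and> (\<forall>w X. cubic_series A w X \<longrightarrow> fps_nth (X i) n = p w)"
    using cubic_series_coeff by blast
  then obtain E where E: "\<And>n i. polynomial_fun (E n i)"
    and E_X: "\<And>n i w X. cubic_series A w X \<Longrightarrow> fps_nth (X i) n = E n i w" by metis
  define a where "a = (\<lambda>w. (B w)\<^sup>2)"
  have a: "polynomial_fun a" unfolding a_def by (intro polynomial_fun_power B)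
  obtain \<alpha> where \<alpha>: "\<And>k. polynomial_fun (\<lambda>w. coeff (\<alpha> w) k)" "\<And>w t. a (t *s w) = poly (\<alpha> w) t"
    using polynomial_fun_ray[OF a] by blast
  \<comment> \<open>Cauchy product of the Taylor coefficients of \<open>a\<close> and of the inverse
    along the ray: the coefficients of the numerator.\<close>
  define b where "b = (\<lambda>i k w. \<Sum>j=0..k. coeff (\<alpha> w) j * E (k - j) i w)"
  have b: "polynomial_fun (b i k)" for i k
    unfolding b_def by (intro polynomial_fun_intros \<alpha> E)
  obtain n where n: "\<And>w i \<tau>. B (\<tau> *s w) \<noteq> 0 \<Longrightarrow>
     \<exists>p. degree p \<le> n \<and> (\<forall>t \<in> ray w. (B (t *s w))\<^sup>2 * G (t *s w) $ i = poly p t)"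
    using B_square_G_polynomial_on_rays by blast
  have near_0: "eventually (\<lambda>t. t \<in> ray w) (nhds 0)" for w
    using open_ray zero_in_ray by (rule eventually_nhds_in_open)
  have a_G: "a (t *s w) * G (t *s w) $ i = (\<Sum>k\<le>n. b i k w * t ^ k)"
    if w: "a (\<tau> *s w) \<noteq> 0" and t: "t *s w \<in> range F" for i w t \<tau>
  proof -
    have Bw: "B (\<tau> *s w) \<noteq> 0" using w by (simp add: a_def)
    obtain p where p: "degree p \<le> n" "\<And>t. t \<in> ray w \<Longrightarrow> a (t *s w) * G (t *s w) $ i = poly p t"
      using n[OF Bw] unfolding a_def by blast
    obtain X where X: "cubic_series A w X" "(\<lambda>t. G (t *s w) $ i) has_fps_expansion X i"
      using G_ray_cubic_series[OF Bw] by blast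
    \<comment> \<open>Identifies the coefficients of \<open>p\<close>, obtained ray by ray, with
      polynomial functions of \<open>w\<close>.\<close>
    have "fps_of_poly p = fps_of_poly (\<alpha> w) * X i"
    proof (rule fps_expansion_unique_complex)
      show "poly p has_fps_expansion fps_of_poly p" by (rule poly_has_fps_expansion)
      have "(\<lambda>t. poly (\<alpha> w) t * G (t *s w) $ i) has_fps_expansion fps_of_poly (\<alpha> w) * X i"
        by (intro fps_expansion_intros X poly_has_fps_expansion)
      moreover have "eventually (\<lambda>t. poly (\<alpha> w) t * G (t *s w) $ i = poly p t) (nhds 0)"
        using near_0[of w] by eventually_elim (simp add: p(2)[symmetric] \<alpha>(2))
      ultimately show "poly p has_fps_expansion fps_of_poly (\<alpha> w) * X i"
        by (rule has_fps_expansion_eventually_eq)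
    qed
    then have "coeff p k = fps_nth (fps_of_poly (\<alpha> w) * X i) k" for k
      by (metis fps_of_poly_nth)
    then have coeff_p: "coeff p k = b i k w" for k
      by (simp add: fps_mult_nth b_def E_X[OF X(1)])
    have "poly p t = (\<Sum>k\<le>n. coeff p k * t ^ k)"
      using p(1) by (rule poly_eq_sum_atMost)
    then show ?thesis using p(2) t coeff_p by simp
  qed
  have G_E: "G w $ i = (\<Sum>k\<le>n. E k i w)" if w: "B w \<noteq> 0" "w \<in> range F" for w i
  proof -
    interpret rational_on_rays F "\<lambda>w. G w $ i" a "b i" n
    proof
      show "continuous_on (range F) (\<lambda>w. G w $ i)" by (intro continuous_intros continuous_on_G)
    qed (use a_G in \<open>auto simp: polynomial_map_cubic_map cubic_map_0 open_range a b\<close>)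
    have Bw: "B (1 *s w) \<noteq> 0" using w by simp
    then have "a (1 *s w) \<noteq> 0" by (simp add: a_def)
    then have "regular w" unfolding regular_def by blast
    then obtain q where q: "degree q \<le> n" "\<And>t. t \<in> ray w \<Longrightarrow> G (t *s w) $ i = poly q t"
      using polynomial_on_rays by blast
    obtain X where X: "cubic_series A w X" "(\<lambda>t. G (t *s w) $ i) has_fps_expansion X i"
      using G_ray_cubic_series[OF Bw] by blast
    have "eventually (\<lambda>t. G (t *s w) $ i = poly q t) (nhds 0)"
      using near_0[of w] by eventually_elim (rule q(2))
    with X(2) have "poly q has_fps_expansion X i" by (rule has_fps_expansion_eventually_eq)
    then have "fps_of_poly q = X i"
      using fps_expansion_unique_complex poly_has_fps_expansion by blast
    then have "coeff q k = E k i w" for k using E_X[OF X(1)] by (metis fps_of_poly_nth)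
    moreover have "poly q 1 = (\<Sum>k\<le>n. coeff q k * 1 ^ k)" using q(1) by (rule poly_eq_sum_atMost)
    moreover have "G w $ i = poly q 1" using q(2)[of 1] w(2) by simp
    ultimately show ?thesis by simp
  qed
  define Q where "Q = (\<lambda>w. \<chi> i. \<Sum>k\<le>n. E k i w)"
  have Q: "polynomial_map Q"
    unfolding polynomial_map_def Q_def by (simp add: polynomial_fun_sum E)
  have "F (Q w) $ i = w $ i" for w i
  proof -
    \<comment> \<open>\<open>Q\<close> agrees with \<open>G\<close> on this open set; it is nonempty
      because \<open>B\<close> cannot vanish on the whole open range.\<close>
    let ?S = "{w. B w \<noteq> 0} \<inter> range F"
    have "polynomial_fun (\<lambda>x. F x $ i)"
      using polynomial_map_cubic_map unfolding polynomial_map_def by blast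
    then have "polynomial_fun (\<lambda>w. F (Q w) $ i - w $ i)"
      by (intro polynomial_fun_diff polynomial_fun_coord polynomial_fun_compose[OF _ Q])
    moreover have "open ?S" by (intro open_Int open_polynomial_fun_nonzero B open_range)
    moreover have "?S \<noteq> {}"
    proof
      assume "?S = {}"
      then have "B w = 0" if "w \<in> range F" for w using that by blast
      then show False using polynomial_fun_eq_0_if_zero_on_open[OF B open_range] B_nz by blast
    qed
    moreover have "F (Q w) $ i - w $ i = 0" if "w \<in> ?S" for w
    proof -
      have "Q w = G w" using G_E that by (simp add: Q_def vec_eq_iff)
      then show ?thesis using that by (simp add: F_G)
    qed
    ultimately have "F (Q w) $ i - w $ i = 0" by (rule polynomial_fun_eq_0_if_zero_on_open)
    then show ?thesis by simp
  qed
  then show ?thesis using Q by (auto simp: vec_eq_iff)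
qed

end

theorem injective_cubic_map_automorphism:
  assumes "inj (cubic_map A)"
  shows "polynomial_automorphism (cubic_map A)"
proof -
  interpret injective_cubic_map A using assms by unfold_locales
  obtain B C N where "polynomial_fun B" "\<exists>w. B w \<noteq> 0" "C \<ge> 0"
     "\<forall>x i. norm (B (F x) * x $ i) \<le> C * (1 + norm (F x)) ^ N"
     "\<forall>x. B (F x) \<noteq> 0 \<longrightarrow> det (secant_matrix A x x) \<noteq> 0"
    using common_denominator_exists by blast
  then interpret cubic_denominator A B C N by unfold_locales auto
  obtain Q where Q: "polynomial_map Q" "\<And>w. F (Q w) = w" using polynomial_right_inverse by blast
  \<comment> \<open>\<open>F (Q (F x)) = F x\<close>, and \<open>F\<close> is injective.\<close>
  then have "Q (F x) = x" for x using inj by (metis injD)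
  then show ?thesis
    unfolding polynomial_automorphism_def
    using Q polynomial_map_cubic_map by (auto intro!: exI[of _ Q])
qed

subsection \<open>Injectivity and the kernel condition\<close>

text \<open>In each coordinate (a + b)^3 - (a - b)^3 = 2 (b^3 + 3 a^2 b) with a from
  \<open>A *v u\<close> and b from \<open>A *v v\<close>; the factor 3 is absorbed by scaling
  \<open>u\<close> with its square root.\<close>

lemma cubic_map_eq_iff:
  fixes A :: "complex ^ 'n ^ 'n"
  shows "cubic_map A (u + v) = cubic_map A (u - v) \<longleftrightarrow>
    v + (A *v v) ^ 3 + A *v v * (A *v (of_real (sqrt 3) *s u))\<^sup>2 = 0"
proof -
  have s: "(complex_of_real (sqrt 3))\<^sup>2 = 3"
    by (simp flip: of_real_power)
  let ?r = "v + (A *v v) ^ 3 + A *v v * (A *v (of_real (sqrt 3) *s u))\<^sup>2"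
  have eq: "(cubic_map A (u + v) - cubic_map A (u - v)) $ i
      = 2 * ?r $ i" for i
    unfolding cubic_map_def matrix_vector_right_distrib matrix_vector_mult_diff_distrib
      vector_scalar_commute
    by (simp add: algebra_simps power2_eq_square power3_eq_cube)
       (simp add: s[unfolded power2_eq_square] flip: mult.assoc)
  have "cubic_map A (u + v) = cubic_map A (u - v)
      \<longleftrightarrow> (\<forall>i. (cubic_map A (u + v) - cubic_map A (u - v)) $ i = 0)"
    by (simp add: vec_eq_iff)
  also have "\<dots> \<longleftrightarrow> (\<forall>i. ?r $ i = 0)" unfolding eq by (simp only: mult_eq_0_iff) simp
  also have "\<dots> \<longleftrightarrow> ?r = 0" by (simp only: vec_eq_iff zero_index)
  finally show ?thesis .
qed

theorem theorem1p5:
  fixes A :: "complex ^ 'n ^ 'n"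
  shows "polynomial_automorphism (cubic_map A) \<longleftrightarrow>
    (\<forall>y z :: complex ^ 'n.
       z + A *v (z ^ 3) + A *v (z * (A *v y) ^ 2) = 0 \<longrightarrow> z = 0)"
proof (intro iffI allI impI)
  fix y z :: "complex ^ 'n"
  assume aut: "polynomial_automorphism (cubic_map A)"
    and eq: "z + A *v (z ^ 3) + A *v (z * (A *v y) ^ 2) = 0"
  from aut have inj: "inj (cubic_map A)"
    unfolding polynomial_automorphism_def by (metis inj_on_id inj_on_imageI2)
  \<comment> \<open>The hypothesis says that \<open>z\<close> is the image of this vector under
    \<open>A\<close>; with \<open>u\<close> below, \<open>v\<close> satisfies the equation of
    \<open>cubic_map_eq_iff\<close>.\<close>
  define v where "v = - (z ^ 3 + z * (A *v y)\<^sup>2)"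
  define u where "u = (1 / of_real (sqrt 3)) *s y"
  have y: "y = of_real (sqrt 3) *s u" by (simp add: u_def vec_eq_iff)
  have "A *v (v + z ^ 3 + z * (A *v y)\<^sup>2) = 0" by (simp add: v_def add.assoc)
  then have "A *v v + A *v (z ^ 3) + A *v (z * (A *v y)\<^sup>2) = z + A *v (z ^ 3) + A *v (z * (A *v y)\<^sup>2)"
    by (simp only: matrix_vector_right_distrib eq)
  then have Av: "A *v v = z" by simp
  have "cubic_map A (u + v) = cubic_map A (u - v)"
    unfolding cubic_map_eq_iff Av y[symmetric] by (simp add: v_def)
  then have "u + v = u - v" using inj by (simp add: inj_eq)
  then have "v = 0" by (simp add: vec_eq_iff)
  then show "z = 0" using Av by simp
next
  assume *: "\<forall>y z :: complex ^ 'n. z + A *v (z ^ 3) + A *v (z * (A *v y) ^ 2) = 0 \<longrightarrow> z = 0"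
  have "inj (cubic_map A)"
  proof (rule injI)
    fix x x' assume eq: "cubic_map A x = cubic_map A x'"
    \<comment> \<open>Midpoint and half-difference bring the two points into the form
      \<open>u + v\<close> and \<open>u - v\<close>.\<close>
    define u where "u = (1 / 2) *s (x + x')"
    define v where "v = (1 / 2) *s (x - x')"
    have x: "x = u + v" "x' = u - v" by (simp_all add: u_def v_def vec_eq_iff field_simps)
    define y where "y = of_real (sqrt 3) *s u"
    have v: "v + (A *v v) ^ 3 + A *v v * (A *v y)\<^sup>2 = 0"
      using eq unfolding x cubic_map_eq_iff y_def .
    \<comment> \<open>Applying \<open>A\<close> gives the equation of the hypothesis for
      \<open>A *v v\<close>; once this vector is 0, the equation for \<open>v\<close> itself reduces
      to \<open>v = 0\<close>.\<close>
    then have "A *v (v + (A *v v) ^ 3 + A *v v * (A *v y)\<^sup>2) = 0" by simp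
    then have "A *v v + A *v ((A *v v) ^ 3) + A *v (A *v v * (A *v y)\<^sup>2) = 0"
      by (simp only: matrix_vector_right_distrib)
    then have "A *v v = 0" using * by blast
    then have "v = 0" using v by simp
    then show "x = x'" by (simp add: x)
  qed
  then show "polynomial_automorphism (cubic_map A)" by (rule injective_cubic_map_automorphism)
qed

end
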